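(* Let $V:\mathbb{R}\to\mathbb{R}$ satisfy: $V\in C^2(\mathbb{R},\mathbb{R})$; $V(x)\ge 0$ for all $x\in\mathbb{R}$ and $V(-1)=V(1)=0$; $V(x)>0$ for all $x\in(-1,1)$; and $V''(-1)>0$, $V''(1)>0$. Let $a:\mathbb{R}\to\mathbb{R}$ be a continuous function, and for $\epsilon>0$ consider the problem $$\ddot{x}(t)=a(\epsilon t)V'(x(t)),\quad t\in\mathbb{R},\qquad x(t)\to -1 \text{ as } t\to-\infty,\quad x(t)\to 1 \text{ as } t\to+\infty. \qquad (P_\epsilon)$$ (i) Suppose $a$ is asymptotically periodic: there is a continuous periodic function $a_P:\mathbb{R}\to\mathbb{R}$ with $|a(t)-a_P(t)|\to 0$ as $|t|\to+\infty$ and $0<\inf_{s\in\mathbb{R}}a(s)\le a(t)<a_P(t)$ for all $t\in\mathbb{R}$. Or suppose $a$ is coercive: $\inf_{t\in\mathbb{R}}a(t)>0$ and $a(t)\to+\infty$ as $|t|\to+\infty$. Then for each $\epsilon>0$, problem $(P_\epsilon)$ has a solution $x\in H^1_{loc}(\mathbb{R})\cap C^2(\mathbb{R})$ with $x(t)\in(-1,1)$ for all $t\in\mathbb{R}$. (ii) Suppose $a$ is bounded and satisfies $\liminf_{|t|\to\infty}a(t)=a_\infty>\inf_{t\in\mathbb{R}}a(t)=a(0)>0$. Then there exists $\epsilon^*>0$ such that for every $\epsilon\in(0,\epsilon^* )$, problem $(P_\epsilon)$ has a solution $x\in H^1_{loc}(\mathbb{R})\cap C^2(\mathbb{R})$ with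 $x(t)\in(-1,1)$ for all $t\in\mathbb{R}$.
   Context: A solution of $(P_\epsilon)$ is called a heteroclinic solution connecting the equilibria $-1$ and $1$. *)

theory Defs
  imports "HOL-Analysis.Analysis"
begin

definition C2 :: "(real \<Rightarrow> real) \<Rightarrow> bool" where
  "C2 f \<longleftrightarrow> (\<forall>t. f differentiable at t) \<and> (\<forall>t. deriv f differentiable at t)
            \<and> continuous_on UNIV (deriv (deriv f))"

text \<open>Solution of (P_eps) (heteroclinic from -1 to 1) taking values in (-1,1).
  C^2 functions on R are automatically in H^1_loc.\<close>
definition het_sol :: "(real \<Rightarrow> real) \<Rightarrow> (real \<Rightarrow> real) \<Rightarrow> real \<Rightarrow> (real \<Rightarrow> real) \<Rightarrow> bool" where
  "het_sol V a \<epsilon> x \<longleftrightarrow> C2 x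
     \<and> (\<forall>t. deriv (deriv x) t = a (\<epsilon> * t) * deriv V (x t))
     \<and> (x \<longlongrightarrow> -1) at_bot \<and> (x \<longlongrightarrow> 1) at_top
     \<and> (\<forall>t. -1 < x t \<and> x t < 1)"

definition asymp_periodic :: "(real \<Rightarrow> real) \<Rightarrow> bool" where
  "asymp_periodic a \<longleftrightarrow> (\<exists>aP. continuous_on UNIV aP \<and> (\<exists>T>0. \<forall>t. aP (t + T) = aP t)
     \<and> ((\<lambda>t. \<bar>a t - aP t\<bar>) \<longlongrightarrow> 0) at_infinity
     \<and> (\<exists>c>0. \<forall>t. c \<le> a t) \<and> (\<forall>t. a t < aP t))"

definition coercive :: "(real \<Rightarrow> real) \<Rightarrow> bool" where
  "coercive a \<longleftrightarrow> (\<exists>c>0. \<forall>t. c \<le> a t) \<and> filterlim a at_top at_infinity"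

end

theory Submission
  imports Defs "HOL-Complex_Analysis.Great_Picard"
begin

text \<open>Minimise the action \<open>\<integral> x'\<^sup>2/2 + b(t) W(x)\<close>, \<open>b(t) = a(\<epsilon> t)\<close>, over Lipschitz curves that equal \<open>-1\<close> near
  \<open>-\<infinity>\<close> and \<open>1\<close> near \<open>+\<infinity>\<close>. A minimising sequence is equi-Hoelder, so a subsequence converges pointwise, and
  the limit solves the equation; finite action forces each of its ends to be a well. What must be excluded is that the transition
  escapes to infinity. If \<open>b\<close> is coercive, a zero far out is too expensive. If \<open>b\<close> is bounded, let \<open>b' \<ge> b\<close>
  be a weight with \<open>b' - b \<rightarrow> 0\<close> at infinity and a strictly larger minimal action: an escaping sequence would have nearly the same
  action for \<open>b\<close> and \<open>b'\<close>, and a limit with a wrong end could be cut off to save action. Suitable weights are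
  \<open>a\<^sub>P(\<epsilon> t)\<close> in the asymptotically periodic case and \<open>max b a\<^sub>1\<close> with \<open>a(0) < a\<^sub>1 < a\<^sub>\<infinity>\<close> in case (ii). The minimal
  action increases strictly with the weight as soon as the larger weight is periodic, because a curve can then be translated
  so that its zero lies in a fixed period.\<close>

section \<open>Lipschitz curves joining the wells\<close>

text \<open>The derivatives of a minimising sequence need not converge pointwise, and the limit need
  not be constant near its ends, so it is in general not an admissible competitor. Its action is
  therefore never formed. The members of the sequence are varied by hat functions instead: a hat has
  piecewise constant slope, so the kinetic term changes by a polynomial in the size of the
  variation, and its coefficients involve the curve only through its values at three points. These
  values and the potential integrals pass to the limit under pointwise convergence. What remains
  says that the limit minus a second antiderivative of \<open>b t * w (x t)\<close> has equal slopes
  on adjacent intervals.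

  Since \<open>V\<close> may vanish again outside [-1, 1], it cannot serve as \<open>W\<close>
  itself; a modification outside the interval is minimised, and a maximum principle together with
  uniqueness for the initial value problem leads back to \<open>V\<close>.\<close>

lemma bounded_borel_integrable_on:
  fixes f h :: "real \<Rightarrow> real"
  assumes "f \<in> borel_measurable borel" "continuous_on {s..t} h"
    and "\<And>u. u \<in> {s..t} \<Longrightarrow> \<bar>f u\<bar> \<le> h u"
  shows "f integrable_on {s..t}"
proof (rule measurable_bounded_by_integrable_imp_integrable_real)
  show "f \<in> borel_measurable (lebesgue_on {s..t})"
    using assms(1) by (intro measurable_restrict_space1 measurable_completion) simp
  show "h integrable_on {s..t}"
    using assms(2) integrable_continuous_real by blast
qed (use assms in auto)

text \<open>\<open>g\<close> is carried along as the derivative of \<open>x\<close>, so that almost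
  everywhere differentiability of Lipschitz functions is never invoked. Being Borel and bounded, it
  has a square that is integrable on bounded intervals.\<close>

definition curve :: "(real \<Rightarrow> real) \<Rightarrow> (real \<Rightarrow> real) \<Rightarrow> bool" where
  "curve x g \<longleftrightarrow> g \<in> borel_measurable borel \<and> (\<exists>K. \<forall>t. \<bar>g t\<bar> \<le> K)
     \<and> (\<forall>s t. s \<le> t \<longrightarrow> (g has_integral (x t - x s)) {s..t})"

lemma curve_lipschitz:
  assumes "curve x g"
  obtains K where "K > 0" "\<And>s t. \<bar>x t - x s\<bar> \<le> K * \<bar>t - s\<bar>"
proof -
  obtain K where K: "\<And>t. \<bar>g t\<bar> \<le> K" using assms unfolding curve_def by blast
  have K0: "K \<ge> 0" using K[of 0] by linarith
  have le: "\<bar>x t - x s\<bar> \<le> K * \<bar>t - s\<bar>" if "s \<le> t" for s t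
    using has_integral_bound_real[of K "{}" g "x t - x s" s t] K that K0 assms
    by (auto simp: curve_def)
  have "\<bar>x t - x s\<bar> \<le> (K + 1) * \<bar>t - s\<bar>" for s t
  proof -
    have "\<bar>x t - x s\<bar> \<le> K * \<bar>t - s\<bar>"
      using le[of s t] le[of t s] by (cases "s \<le> t") (auto simp: abs_minus_commute)
    also have "\<dots> \<le> (K + 1) * \<bar>t - s\<bar>" by (simp add: mult_right_mono)
    finally show ?thesis .
  qed
  then show ?thesis using that[of "K + 1"] K0 by auto
qed

lemma curve_continuous:
  assumes "curve x g"
  shows "continuous_on A x"
proof -
  obtain K where K: "K > 0" "\<And>s t. \<bar>x t - x s\<bar> \<le> K * \<bar>t - s\<bar>"
    using curve_lipschitz[OF assms] by blast
  have "K-lipschitz_on A x"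
    by (rule lipschitz_onI) (use K in \<open>auto simp: dist_real_def\<close>)
  then show ?thesis by (rule lipschitz_on_continuous_on)
qed

lemma curve_has_integral:
  "curve x g \<Longrightarrow> s \<le> t \<Longrightarrow> (g has_integral (x t - x s)) {s..t}"
  unfolding curve_def by blast

lemma curve_measurable: "curve x g \<Longrightarrow> g \<in> borel_measurable borel"
  unfolding curve_def by blast

lemma curve_splice:
  assumes "curve x g" "curve y h" "x s = y s"
  shows "curve (\<lambda>t. if t \<le> s then x t else y t) (\<lambda>t. if t \<le> s then g t else h t)"
    (is "curve ?z ?k")
proof -
  have m: "?k \<in> borel_measurable borel"
    using curve_measurable[OF assms(1)] curve_measurable[OF assms(2)] by measurable
  obtain K L where KL: "\<And>t. \<bar>g t\<bar> \<le> K" "\<And>t. \<bar>h t\<bar> \<le> L"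
    using assms unfolding curve_def by blast
  have b: "\<forall>t. \<bar>?k t\<bar> \<le> max K L"
  proof
    fix t show "\<bar>?k t\<bar> \<le> max K L" using KL(1)[of t] KL(2)[of t] by auto
  qed
  have left: "(?k has_integral (?z v - ?z u)) {u..v}" if "u \<le> v" "v \<le> s" for u v
  proof -
    have "(?k has_integral (x v - x u)) {u..v}"
      by (rule has_integral_eq[OF _ curve_has_integral[OF assms(1) that(1)]]) (use that in auto)
    then show ?thesis using that by simp
  qed
  have right: "(?k has_integral (?z v - ?z u)) {u..v}" if "u \<le> v" "s \<le> u" for u v
  proof -
    \<comment> \<open>On this side \<open>?k\<close> differs from \<open>h\<close> at most at
      \<open>s\<close>, where it takes the value \<open>g s\<close>; a single point does not affect
      the integral.\<close>
    have "(?k has_integral (y v - y u)) {u..v}"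
      by (rule has_integral_spike_finite[of "{s}", OF _ _ curve_has_integral[OF assms(2) that(1)]])
        (use that in auto)
    then show ?thesis using that assms(3) by (cases "v = s"; cases "u = s") auto
  qed
  have "(?k has_integral (?z v - ?z u)) {u..v}" if uv: "u \<le> v" for u v
  proof -
    consider "v \<le> s" | "s \<le> u" | "u \<le> s" "s \<le> v" by linarith
    then show ?thesis
    proof cases
      case 3
      show ?thesis
        using has_integral_combine[OF 3 left[OF 3(1)] right[OF 3(2)]] by simp
    qed (use left right uv in auto)
  qed
  with m b show ?thesis unfolding curve_def by blast
qed

lemma curve_affine: "curve (\<lambda>t. \<alpha> + \<beta> * t) (\<lambda>_. \<beta>)"
proof -
  have "((\<lambda>_. \<beta>) has_integral (\<alpha> + \<beta> * t - (\<alpha> + \<beta> * s))) {s..t}" if "s \<le> t" for s t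
    using has_integral_const_real[of \<beta> s t] that by (simp add: algebra_simps)
  then show ?thesis unfolding curve_def by auto
qed

lemma curve_const: "curve (\<lambda>t. \<alpha>) (\<lambda>_. 0)"
  using curve_affine[of \<alpha> 0] by simp

lemma curve_add_scaled:
  assumes "curve x g" "curve y h"
  shows "curve (\<lambda>t. x t + \<sigma> * y t) (\<lambda>t. g t + \<sigma> * h t)"
proof -
  obtain K L where KL: "\<And>t. \<bar>g t\<bar> \<le> K" "\<And>t. \<bar>h t\<bar> \<le> L"
    using assms unfolding curve_def by blast
  have "\<bar>g t + \<sigma> * h t\<bar> \<le> K + \<bar>\<sigma>\<bar> * L" for t
  proof -
    have "\<bar>g t + \<sigma> * h t\<bar> \<le> \<bar>g t\<bar> + \<bar>\<sigma>\<bar> * \<bar>h t\<bar>"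
      by (metis abs_mult abs_triangle_ineq)
    also have "\<dots> \<le> K + \<bar>\<sigma>\<bar> * L" using KL by (intro add_mono mult_left_mono) auto
    finally show ?thesis .
  qed
  moreover have "((\<lambda>t. g t + \<sigma> * h t) has_integral (x t + \<sigma> * y t - (x s + \<sigma> * y s))) {s..t}"
    if "s \<le> t" for s t
    using has_integral_add[OF curve_has_integral[OF assms(1) that]
        has_integral_mult_right[OF curve_has_integral[OF assms(2) that], of \<sigma>]]
    by (simp add: algebra_simps)
  moreover have "(\<lambda>t. g t + \<sigma> * h t) \<in> borel_measurable borel"
    using curve_measurable[OF assms(1)] curve_measurable[OF assms(2)] by measurable
  ultimately show ?thesis unfolding curve_def by blast
qed

lemma has_integral_shift_real:
  fixes f :: "real \<Rightarrow> real"
  assumes "(f has_integral i) {s + k..t + k}"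
  shows "((\<lambda>u. f (u + k)) has_integral i) {s..t}"
proof -
  have "(\<lambda>x::real. x - k) ` {s + k..t + k} = {s..t}"
    using image_add_atLeastAtMost'[of "-k" "s + k" "t + k"] by simp
  with has_integral_affinity[of f i "s + k" "t + k" 1 k] assms show ?thesis by simp
qed

lemma curve_shift:
  assumes "curve x g"
  shows "curve (\<lambda>t. x (t + k)) (\<lambda>t. g (t + k))"
proof -
  have "((\<lambda>u. g (u + k)) has_integral (x (t + k) - x (s + k))) {s..t}" if "s \<le> t" for s t
    by (rule has_integral_shift_real, rule curve_has_integral[OF assms]) (use that in simp)
  moreover have "(\<lambda>t. g (t + k)) \<in> borel_measurable borel"
    using curve_measurable[OF assms] by measurable
  ultimately show ?thesis using assms unfolding curve_def by blast
qed

text \<open>Since \<open>g\<close> vanishes at every point of the tails, and not only almost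
  everywhere, the Lagrangian vanishes there pointwise. Each action is then an integral over a
  bounded interval, and integrands can be compared point by point.\<close>

definition transition :: "(real \<Rightarrow> real) \<Rightarrow> (real \<Rightarrow> real) \<Rightarrow> bool" where
  "transition x g \<longleftrightarrow> curve x g \<and>
     (\<exists>S. \<forall>t. (t \<le> -S \<longrightarrow> x t = -1 \<and> g t = 0) \<and> (t \<ge> S \<longrightarrow> x t = 1 \<and> g t = 0))"

lemma transition_curve: "transition x g \<Longrightarrow> curve x g"
  unfolding transition_def by blast

lemma transitionE:
  assumes "transition x g"
  obtains S where "S > R" "\<And>t. t \<le> -S \<Longrightarrow> x t = -1" "\<And>t. t \<le> -S \<Longrightarrow> g t = 0"
    "\<And>t. t \<ge> S \<Longrightarrow> x t = 1" "\<And>t. t \<ge> S \<Longrightarrow> g t = 0"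
proof -
  obtain S where S: "\<forall>t. (t \<le> -S \<longrightarrow> x t = -1 \<and> g t = 0) \<and> (t \<ge> S \<longrightarrow> x t = 1 \<and> g t = 0)"
    using assms unfolding transition_def by blast
  show ?thesis by (rule that[of "max S (R + 1)"]) (use S in auto)
qed

lemma transitionI:
  assumes "curve x g" "\<And>t. t \<le> p \<Longrightarrow> x t = -1 \<and> g t = 0" "\<And>t. t \<ge> q \<Longrightarrow> x t = 1 \<and> g t = 0"
  shows "transition x g"
  unfolding transition_def
  by (rule conjI[OF assms(1)], rule exI[of _ "max (-p) q"]) (use assms(2,3) in auto)

lemma transition_shift:
  assumes "transition x g"
  shows "transition (\<lambda>t. x (t + k)) (\<lambda>t. g (t + k))"
proof -
  obtain S where S: "S > 0" "\<And>t. t \<le> -S \<Longrightarrow> x t = -1" "\<And>t. t \<le> -S \<Longrightarrow> g t = 0"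
    "\<And>t. t \<ge> S \<Longrightarrow> x t = 1" "\<And>t. t \<ge> S \<Longrightarrow> g t = 0"
    using transitionE[OF assms] by blast
  show ?thesis
    by (rule transitionI[OF curve_shift[OF transition_curve[OF assms]], where p="-S-k" and q="S-k"])
      (use S in auto)
qed

lemma transition_exists: "\<exists>x g. transition x g"
proof -
  let ?x = "\<lambda>t::real. if t \<le> 1 then (if t \<le> -1 then -1 else 0 + 1 * t) else 1"
  let ?g = "\<lambda>t::real. if t \<le> 1 then (if t \<le> -1 then 0 else 1) else (0::real)"
  have "curve ?x ?g"
    by (intro curve_splice curve_affine curve_const) auto
  then have "transition ?x ?g" by (rule transitionI[of _ _ "-1" 2]) auto
  then show ?thesis by blast
qed

lemma transition_zero:
  assumes "transition x g"
  obtains \<tau> where "x \<tau> = 0"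
proof -
  obtain S where S: "S > 0" "\<And>t. t \<le> -S \<Longrightarrow> x t = -1" "\<And>t. t \<ge> S \<Longrightarrow> x t = 1"
    using transitionE[OF assms] by metis
  then show ?thesis
    using IVT'[of x "-S" 0 S] curve_continuous[OF transition_curve[OF assms]] that by auto
qed

section \<open>The action and its minimal level\<close>

text \<open>\<open>W_away\<close> strengthens \<open>W_zero\<close> to a lower bound that is uniform
  up to infinity. For a weight bounded below by a positive constant it turns a bound on the action
  into a bound on the time spent away from the wells.\<close>

locale double_well =
  fixes W w :: "real \<Rightarrow> real"
  assumes W_deriv: "(W has_real_derivative w y) (at y)"
    and w_cont: "continuous_on UNIV w"
    and W_nonneg: "0 \<le> W y"
    and W_zero: "W y = 0 \<longleftrightarrow> y = 1 \<or> y = -1"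
    and W_away: "\<delta> > 0 \<Longrightarrow> \<exists>\<mu>>0. \<forall>y. \<delta> \<le> \<bar>y - 1\<bar> \<longrightarrow> \<delta> \<le> \<bar>y + 1\<bar> \<longrightarrow> \<mu> \<le> W y"
begin

lemma W_cont: "continuous_on A W"
  using W_deriv DERIV_isCont continuous_at_imp_continuous_on by blast

lemma W_cont_comp: "continuous_on A x \<Longrightarrow> continuous_on A (\<lambda>t. W (x t))"
  by (rule continuous_on_compose2[OF W_cont[of UNIV]]) auto

definition lagrangian :: "(real \<Rightarrow> real) \<Rightarrow> (real \<Rightarrow> real) \<Rightarrow> (real \<Rightarrow> real) \<Rightarrow> real \<Rightarrow> real" where
  "lagrangian b x g t = (g t)\<^sup>2 / 2 + b t * W (x t)"

definition action :: "(real \<Rightarrow> real) \<Rightarrow> (real \<Rightarrow> real) \<Rightarrow> (real \<Rightarrow> real) \<Rightarrow> real" where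
  "action b x g = integral UNIV (lagrangian b x g)"

definition level :: "(real \<Rightarrow> real) \<Rightarrow> real" where
  "level b = Inf {action b x g | x g. transition x g}"

lemma lagrangian_integrable:
  assumes "curve x g" "continuous_on UNIV b"
  shows "lagrangian b x g integrable_on {s..t}"
proof -
  obtain K where K: "\<And>t. \<bar>g t\<bar> \<le> K" using assms unfolding curve_def by blast
  have bm: "(\<lambda>t. b t * W (x t)) \<in> borel_measurable borel"
    by (intro borel_measurable_continuous_onI continuous_intros W_cont_comp curve_continuous[OF assms(1)] assms(2))
  have "(\<lambda>t. (g t)\<^sup>2 / 2 + b t * W (x t)) integrable_on {s..t}"
  proof (rule bounded_borel_integrable_on)
    show "(\<lambda>t. (g t)\<^sup>2 / 2 + b t * W (x t)) \<in> borel_measurable borel"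
      using bm curve_measurable[OF assms(1)] by measurable
    show "continuous_on {s..t} (\<lambda>t. K\<^sup>2 / 2 + \<bar>b t * W (x t)\<bar>)"
      by (intro continuous_intros W_cont_comp curve_continuous[OF assms(1)]
          continuous_on_subset[OF assms(2)]) auto
    fix u
    have "(g u)\<^sup>2 \<le> K\<^sup>2" using K[of u] by (metis abs_ge_zero power2_abs power_mono)
    then show "\<bar>(g u)\<^sup>2 / 2 + b u * W (x u)\<bar> \<le> K\<^sup>2 / 2 + \<bar>b u * W (x u)\<bar>"
      using zero_le_power2[of "g u"] by linarith
  qed
  then show ?thesis by (simp add: lagrangian_def[abs_def])
qed

lemma lagrangian_nonneg: "0 \<le> b t \<Longrightarrow> 0 \<le> lagrangian b x g t"
  unfolding lagrangian_def using W_nonneg[of "x t"] by simp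

lemma transition_lagrangianE:
  assumes "transition x g"
  obtains S where "S > R" "\<And>t. t \<le> -S \<or> t \<ge> S \<Longrightarrow> W (x t) = 0"
    "\<And>b t. t \<le> -S \<or> t \<ge> S \<Longrightarrow> lagrangian b x g t = 0"
proof -
  obtain S where S: "S > R" "\<And>t. t \<le> -S \<Longrightarrow> x t = -1" "\<And>t. t \<le> -S \<Longrightarrow> g t = 0"
    "\<And>t. t \<ge> S \<Longrightarrow> x t = 1" "\<And>t. t \<ge> S \<Longrightarrow> g t = 0"
    using transitionE[OF assms] by blast
  then have *: "W (x t) = 0" "g t = 0" if "t \<le> -S \<or> t \<ge> S" for t
    using that W_zero by auto
  show ?thesis
    by (rule that[OF S(1)]) (auto simp: lagrangian_def *)
qed

lemma action_has_integral:
  assumes "transition x g" "continuous_on UNIV b"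
    and "\<And>t. t < p \<or> t > q \<Longrightarrow> lagrangian b x g t = 0"
  shows "(lagrangian b x g has_integral action b x g) {p..q}"
proof -
  have *: "(lagrangian b x g has_integral integral {p..q} (lagrangian b x g)) {p..q}"
    by (rule integrable_integral[OF lagrangian_integrable[OF transition_curve[OF assms(1)] assms(2)]])
  have "(lagrangian b x g has_integral integral {p..q} (lagrangian b x g)) UNIV"
    by (rule has_integral_on_superset[OF *]) (use assms(3) in auto)
  then show ?thesis unfolding action_def using * integral_unique by metis
qed

lemma action_UNIV:
  assumes "transition x g" "continuous_on UNIV b"
  shows "(lagrangian b x g has_integral action b x g) UNIV"
proof -
  obtain S where S: "\<And>b t. t \<le> -S \<or> t \<ge> S \<Longrightarrow> lagrangian b x g t = 0"
    using transition_lagrangianE[OF assms(1)] by metis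
  show ?thesis
    by (rule has_integral_on_superset[OF action_has_integral[OF assms, of "-S" S]]) (use S in auto)
qed

lemma integral_lagrangian_le_action:
  assumes "transition x g" "continuous_on UNIV b" "\<And>t. 0 \<le> b t"
  shows "integral {s..t} (lagrangian b x g) \<le> action b x g"
  unfolding action_def
  by (rule integral_subset_le)
    (use lagrangian_integrable[OF transition_curve] has_integral_integrable[OF action_UNIV]
      lagrangian_nonneg assms in auto)

lemma integral_potential_le_action:
  assumes "transition x g" "continuous_on UNIV b" "\<And>t. 0 \<le> b t"
  shows "integral {s..t} (\<lambda>u. b u * W (x u)) \<le> action b x g"
proof -
  have "integral {s..t} (\<lambda>u. b u * W (x u)) \<le> integral {s..t} (lagrangian b x g)"
  proof (rule integral_le)
    show "(\<lambda>u. b u * W (x u)) integrable_on {s..t}"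
      by (intro integrable_continuous_real continuous_intros W_cont_comp
          curve_continuous[OF transition_curve[OF assms(1)]] continuous_on_subset[OF assms(2)]) auto
  qed (use assms lagrangian_integrable[OF transition_curve] in \<open>auto simp: lagrangian_def\<close>)
  then show ?thesis using integral_lagrangian_le_action[OF assms, of s t] by linarith
qed

lemma action_nonneg:
  assumes "\<And>t. 0 \<le> b t"
  shows "0 \<le> action b x g"
  unfolding action_def
  by (cases "lagrangian b x g integrable_on UNIV")
    (auto intro!: integral_nonneg simp: lagrangian_nonneg assms not_integrable_integral)

text \<open>The integrand dominates \<open>\<mu> x' - \<mu>\<^sup>2 / 2\<close> for every slope \<open>\<mu>\<close>; the average slope is optimal.\<close>

lemma action_hoelder:
  assumes "transition x g" "continuous_on UNIV b" "\<And>t. 0 \<le> b t" "action b x g \<le> M"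
  shows "(x t - x s)\<^sup>2 \<le> 2 * M * \<bar>t - s\<bar>"
proof -
  have *: "(x t - x s)\<^sup>2 \<le> 2 * M * (t - s)" if "s < t" for s t
  proof -
    define \<mu> where "\<mu> = (x t - x s) / (t - s)"
    have 1: "((\<lambda>u. \<mu> * g u - \<mu>\<^sup>2 / 2) has_integral (\<mu> * (x t - x s) - (t - s) * (\<mu>\<^sup>2 / 2))) {s..t}"
      using has_integral_diff[OF has_integral_mult_right[OF curve_has_integral[OF transition_curve[OF assms(1)]]]
          has_integral_const_real[of "\<mu>\<^sup>2/2" s t], of \<mu>] that by simp
    have "\<mu> * (x t - x s) - (t - s) * (\<mu>\<^sup>2 / 2) \<le> integral {s..t} (lagrangian b x g)"
    proof (rule has_integral_le[OF 1])
      show "(lagrangian b x g has_integral integral {s..t} (lagrangian b x g)) {s..t}"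
        using lagrangian_integrable[OF transition_curve[OF assms(1)] assms(2)] by blast
      fix u
      have "0 \<le> (g u - \<mu>)\<^sup>2" "0 \<le> b u * W (x u)" using W_nonneg assms(3) by auto
      then show "\<mu> * g u - \<mu>\<^sup>2 / 2 \<le> lagrangian b x g u"
        by (simp add: lagrangian_def power2_eq_square algebra_simps)
    qed
    also have "\<dots> \<le> M" using integral_lagrangian_le_action[OF assms(1-3)] assms(4) by (rule order_trans)
    finally have "\<mu> * (x t - x s) - (t - s) * (\<mu>\<^sup>2 / 2) \<le> M" .
    moreover have "\<mu> * (x t - x s) - (t - s) * (\<mu>\<^sup>2 / 2) = (x t - x s)\<^sup>2 / (2 * (t - s))"
    proof -
      have "D / T * D - T * ((D / T)\<^sup>2 / 2) = D\<^sup>2 / (2 * T)" if "T > 0" for D T :: real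
        using that by (simp add: field_simps power2_eq_square)
      from this[of "t - s" "x t - x s"] that show ?thesis unfolding \<mu>_def by simp
    qed
    ultimately have "(x t - x s)\<^sup>2 / (2 * (t - s)) \<le> M" by simp
    then show ?thesis using that by (simp add: pos_divide_le_eq mult_ac)
  qed
  show ?thesis
    using *[of s t] *[of t s] by (cases s t rule: linorder_cases) (auto simp: power2_commute)
qed

lemma level_le:
  assumes "transition x g" "\<And>t. 0 \<le> b t"
  shows "level b \<le> action b x g"
  unfolding level_def
  by (rule cInf_lower) (use assms action_nonneg in \<open>auto simp: bdd_below_def intro!: exI[of _ 0]\<close>)

lemma level_approx:
  assumes "0 < e"
  obtains x g where "transition x g" "action b x g < level b + e"
proof -
  have "\<exists>y\<in>{action b x g | x g. transition x g}. y < level b + e"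
    unfolding level_def by (rule cInf_lessD) (use assms transition_exists in auto)
  then show ?thesis using that by auto
qed

lemma level_greatest:
  assumes "\<And>x g. transition x g \<Longrightarrow> l \<le> action b x g"
  shows "l \<le> level b"
  unfolding level_def by (rule cInf_greatest) (use assms transition_exists in auto)

lemma level_nonneg: "(\<And>t. 0 \<le> b t) \<Longrightarrow> 0 \<le> level b"
  by (rule level_greatest) (rule action_nonneg)

lemma action_mono:
  assumes "transition x g" "continuous_on UNIV b" "continuous_on UNIV b'" "\<And>t. b t \<le> b' t"
  shows "action b x g \<le> action b' x g"
  by (rule has_integral_le[OF action_UNIV[OF assms(1,2)] action_UNIV[OF assms(1,3)]])
    (simp add: lagrangian_def mult_right_mono assms(4) W_nonneg)

lemma level_mono:
  assumes "continuous_on UNIV b" "continuous_on UNIV b'" "\<And>t. b t \<le> b' t" "\<And>t. 0 \<le> b t"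
  shows "level b \<le> level b'"
proof (rule level_greatest)
  fix x g assume t: "transition x g"
  show "level b \<le> action b' x g"
    by (rule order_trans[OF level_le[OF t assms(4)] action_mono[OF t assms(1-3)]])
qed

lemma action_diff:
  assumes "transition x g" "continuous_on UNIV b" "continuous_on UNIV b'"
    and "\<And>t. t < p \<or> t > q \<Longrightarrow> W (x t) = 0"
  shows "action b' x g - action b x g = integral {p..q} (\<lambda>t. (b' t - b t) * W (x t))"
proof -
  have 1: "((\<lambda>t. lagrangian b' x g t - lagrangian b x g t) has_integral (action b' x g - action b x g)) UNIV"
    by (intro has_integral_diff action_UNIV assms)
  have 2: "lagrangian b' x g t - lagrangian b x g t = (b' t - b t) * W (x t)" for t
    by (simp add: lagrangian_def algebra_simps)
  have "(\<lambda>t. (b' t - b t) * W (x t)) integrable_on {p..q}"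
    by (intro integrable_continuous_real continuous_intros W_cont_comp
        curve_continuous[OF transition_curve[OF assms(1)]] continuous_on_subset[OF assms(2)]
        continuous_on_subset[OF assms(3)]) auto
  then have "((\<lambda>t. (b' t - b t) * W (x t)) has_integral integral {p..q} (\<lambda>t. (b' t - b t) * W (x t))) UNIV"
    by (intro has_integral_on_superset[OF integrable_integral]) (use assms(4) in auto)
  with 1 show ?thesis unfolding 2 by (rule has_integral_unique)
qed

section \<open>Compactness of curves of bounded action\<close>

text \<open>A curve that stayed outside [-2, 2] throughout \<open>{0..L}\<close> would pay at least
  \<open>c * \<mu> * L\<close>; \<open>L\<close> is chosen so that this is
  \<open>\<bar>M\<bar> + c * \<mu>\<close>, which exceeds \<open>M\<close>. So the curve is in
  [-2, 2] at some time in \<open>{0..L}\<close>, and the Hoelder estimate carries the bound to all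
  other times.\<close>

lemma transitions_locally_bounded:
  assumes "continuous_on UNIV b" "0 < c" "\<And>t. c \<le> b t"
  shows "\<exists>A>0. \<forall>x g. transition x g \<longrightarrow> action b x g \<le> M \<longrightarrow> (\<forall>t. \<bar>x t\<bar> \<le> A + \<bar>t\<bar>)"
proof -
  obtain \<mu> where \<mu>: "\<mu> > 0" "\<And>y. 1 \<le> \<bar>y - 1\<bar> \<Longrightarrow> 1 \<le> \<bar>y + 1\<bar> \<Longrightarrow> \<mu> \<le> W y"
    using W_away[of 1] by auto
  have b0: "0 \<le> b t" for t using assms(2) assms(3)[of t] by linarith
  define L where "L = \<bar>M\<bar> / (c * \<mu>) + 1"
  have L: "L > 0" using \<mu> assms(2) unfolding L_def by (simp add: add_nonneg_pos)
  have "\<bar>x t\<bar> \<le> (2 + \<bar>M\<bar> + L) + \<bar>t\<bar>" if x: "transition x g" "action b x g \<le> M" for x g t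
  proof -
    have "\<exists>s\<in>{0..L}. \<bar>x s\<bar> \<le> 2"
    proof (rule ccontr)
      assume neg: "\<not> ?thesis"
      have "integral {0..L} (\<lambda>_. c * \<mu>) \<le> integral {0..L} (\<lambda>u. b u * W (x u))"
      proof (rule integral_le)
        show "(\<lambda>u. b u * W (x u)) integrable_on {0..L}"
          by (intro integrable_continuous_real continuous_intros W_cont_comp
              curve_continuous[OF transition_curve[OF x(1)]] continuous_on_subset[OF assms(1)]) auto
        fix u assume "u \<in> {0..L}"
        then have "\<mu> \<le> W (x u)" using neg by (intro \<mu>(2)) force+
        then show "c * \<mu> \<le> b u * W (x u)" using assms \<mu> b0 by (intro mult_mono) auto
      qed auto
      then have "c * \<mu> * L \<le> M"
        using integral_potential_le_action[OF x(1) assms(1) b0, of 0 L] x(2) L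
        by (simp add: mult_ac)
      moreover have "c * \<mu> * L = \<bar>M\<bar> + c * \<mu>" using \<mu> assms(2) unfolding L_def by (simp add: field_simps)
      moreover have "c * \<mu> > 0" using \<mu> assms(2) by simp
      ultimately show False by linarith
    qed
    then obtain s where s: "s \<in> {0..L}" "\<bar>x s\<bar> \<le> 2" by blast
    have "(x t - x s)\<^sup>2 \<le> 2 * \<bar>M\<bar> * \<bar>t - s\<bar>"
      by (rule action_hoelder[OF x(1) assms(1) b0]) (use x(2) in linarith)
    also have "\<dots> \<le> (\<bar>M\<bar> + \<bar>t - s\<bar>)\<^sup>2" by (simp add: power2_sum)
    finally have "\<bar>x t - x s\<bar> \<le> \<bar>M\<bar> + \<bar>t - s\<bar>" by (simp add: abs_le_square_iff[symmetric])
    with s show ?thesis by auto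
  qed
  then show ?thesis using L by (intro exI[of _ "2 + \<bar>M\<bar> + L"]) auto
qed

text \<open>Arzela-Ascoli in a pointwise form: a diagonal subsequence converges at all rational
  times, and the common Hoelder bound extends the convergence to the remaining times and is
  inherited by the limit.\<close>

lemma transitions_convergent_subsequence:
  assumes b: "continuous_on UNIV b" "0 < c" "\<And>t. c \<le> b t"
    and X: "\<And>n::nat. transition (X n) (G n)" "\<And>n. action b (X n) (G n) \<le> M"
  obtains r x where "strict_mono r" "\<And>t. (\<lambda>n. X (r n) t) \<longlonglongrightarrow> x t" "\<And>s t. (x t - x s)\<^sup>2 \<le> 2 * M * \<bar>t - s\<bar>"
proof -
  have b0: "0 \<le> b t" for t using b(2) b(3)[of t] by linarith
  have M0: "0 \<le> M" using action_nonneg[of b "X 0" "G 0", OF b0] X(2)[of 0] by linarith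
  obtain A where A: "A > 0" "\<And>n t. \<bar>X n t\<bar> \<le> A + \<bar>t\<bar>"
    using transitions_locally_bounded[OF b, of M] X by blast
  have hoe: "(X n t - X n s)\<^sup>2 \<le> 2 * M * \<bar>t - s\<bar>" for n s t
    by (rule action_hoelder[OF X(1) b(1) b0 X(2)])
  \<comment> \<open>The diagonal argument takes one bound for all times, so the curves are divided
    by their linear bound.\<close>
  define f where "f n t = X n t / (A + \<bar>t\<bar>)" for n t
  obtain r where r: "strict_mono r" "\<And>t. t \<in> \<rat> \<Longrightarrow> \<exists>l. (\<lambda>n. f (r n) t) \<longlonglongrightarrow> l"
  proof (rule function_convergent_subsequence[of "\<rat>" f 1])
    show "countable (\<rat>::real set)" by (rule countable_rat)
    show "norm (f n t) \<le> 1" for n t using A(1) A(2)[of n t] by (simp add: f_def)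
  qed blast
  have rat: "Cauchy (\<lambda>n. X (r n) t)" if t: "t \<in> \<rat>" for t
  proof -
    obtain l where "(\<lambda>n. f (r n) t) \<longlonglongrightarrow> l" using r(2)[OF t] by blast
    then have "(\<lambda>n. f (r n) t * (A + \<bar>t\<bar>)) \<longlonglongrightarrow> l * (A + \<bar>t\<bar>)" by (intro tendsto_intros)
    moreover have "f (r n) t * (A + \<bar>t\<bar>) = X (r n) t" for n using A(1) by (simp add: f_def)
    ultimately have "(\<lambda>n. X (r n) t) \<longlonglongrightarrow> l * (A + \<bar>t\<bar>)" by simp
    then show ?thesis by (rule LIMSEQ_imp_Cauchy)
  qed
  have "Cauchy (\<lambda>n. X (r n) t)" for t
  proof (rule metric_CauchyI)
    fix e :: real assume e: "e > 0"
    \<comment> \<open>Within time \<open>d\<close> every curve moves by less than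
      \<open>e/3\<close>. The summand 1 covers the case \<open>M = 0\<close>.\<close>
    define d where "d = (e/3)\<^sup>2 / (2 * M + 1)"
    have d: "d > 0" using e M0 unfolding d_def by simp
    obtain q where q: "q \<in> \<rat>" "t < q" "q < t + d" using Rats_dense_in_real[of t "t + d"] d by auto
    have close: "\<bar>X n t - X n q\<bar> < e/3" for n
    proof -
      have "(X n t - X n q)\<^sup>2 \<le> 2 * M * \<bar>t - q\<bar>" by (rule hoe)
      also have "\<dots> \<le> 2 * M * d" using q M0 by (intro mult_left_mono) auto
      also have "\<dots> < (2 * M + 1) * d" using d by simp
      also have "\<dots> = (e/3)\<^sup>2" using M0 by (simp add: d_def)
      finally have "\<bar>X n t - X n q\<bar>\<^sup>2 < (e/3)\<^sup>2" by simp
      then show ?thesis by (rule power2_less_imp_less) (use e in simp)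
    qed
    obtain N where N: "\<And>m n. m \<ge> N \<Longrightarrow> n \<ge> N \<Longrightarrow> dist (X (r m) q) (X (r n) q) < e/3"
      using metric_CauchyD[OF rat[OF q(1)], of "e/3"] e by auto
    have "dist (X (r m) t) (X (r n) t) < e" if "m \<ge> N" "n \<ge> N" for m n
      using N[OF that] close[of "r m"] close[of "r n"] unfolding dist_real_def by linarith
    then show "\<exists>N. \<forall>m\<ge>N. \<forall>n\<ge>N. dist (X (r m) t) (X (r n) t) < e" by blast
  qed
  then have "\<exists>l. (\<lambda>n. X (r n) t) \<longlonglongrightarrow> l" for t
    using Cauchy_convergent_iff convergent_def by blast
  then obtain x where x: "\<And>t. (\<lambda>n. X (r n) t) \<longlonglongrightarrow> x t" by metis
  have "(x t - x s)\<^sup>2 \<le> 2 * M * \<bar>t - s\<bar>" for s t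
    by (rule LIMSEQ_le_const2[OF tendsto_power[OF tendsto_diff[OF x[of t] x[of s]]]])
      (use hoe in blast)
  with r(1) x show ?thesis using that by blast
qed

end

lemma hoelder_continuous:
  fixes x :: "real \<Rightarrow> real"
  assumes "\<And>s t. (x t - x s)\<^sup>2 \<le> C * \<bar>t - s\<bar>"
  shows "continuous_on A x"
proof -
  have C: "C \<ge> 0" using order_trans[OF zero_le_power2 assms[of 1 0]] by simp
  have "isCont x s" for s
  proof -
    have "((\<lambda>t. sqrt (C * \<bar>t - s\<bar>)) \<longlongrightarrow> sqrt (C * \<bar>s - s\<bar>)) (at s)" by (intro tendsto_intros)
    then have z: "((\<lambda>t. sqrt (C * \<bar>t - s\<bar>)) \<longlongrightarrow> 0) (at s)" by simp
    have "((\<lambda>t. x t - x s) \<longlongrightarrow> 0) (at s)"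
    proof (rule tendsto_rabs_zero_cancel, rule tendsto_sandwich[OF _ _ tendsto_const z])
      show "\<forall>\<^sub>F t in at s. \<bar>x t - x s\<bar> \<le> sqrt (C * \<bar>t - s\<bar>)"
        by (rule always_eventually) (use assms real_le_rsqrt in force)
    qed simp
    then show ?thesis by (simp add: isCont_def LIM_zero_iff)
  qed
  then show ?thesis by (simp add: continuous_at_imp_continuous_on)
qed

text \<open>Over \<open>{s..t}\<close> the graphs of all \<open>X n\<close> lie in one compact box,
  on which \<open>F\<close> is bounded. A constant therefore dominates the integrands, and pointwise
  convergence suffices.\<close>

lemma integral_pointwise_limit:
  fixes F :: "real \<Rightarrow> real \<Rightarrow> real"
  assumes F: "continuous_on UNIV (\<lambda>(u, y). F u y)"
    and X: "\<And>n::nat. continuous_on UNIV (X n)" "\<And>n t. \<bar>X n t\<bar> \<le> A + \<bar>t\<bar>"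
    and lim: "\<And>t. (\<lambda>n. X n t) \<longlonglongrightarrow> x t"
  shows "(\<lambda>n. integral {s..t} (\<lambda>u. F u (X n u))) \<longlonglongrightarrow> integral {s..t} (\<lambda>u. F u (x u))"
proof -
  have comp: "continuous_on S (\<lambda>u. F u (y u))" if "continuous_on UNIV y" for y S
  proof -
    have "continuous_on S ((\<lambda>(u, y). F u y) \<circ> (\<lambda>u. (u, y u)))"
      by (intro continuous_on_compose continuous_intros continuous_on_subset[OF that]
          continuous_on_subset[OF F]) auto
    then show ?thesis by (simp add: o_def)
  qed
  define R where "R = A + max \<bar>s\<bar> \<bar>t\<bar>"
  have "compact ((\<lambda>(u, y). F u y) ` ({s..t} \<times> {-R..R}))"
    by (intro compact_continuous_image continuous_on_subset[OF F] compact_Times) auto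
  then have "bounded ((\<lambda>(u, y). F u y) ` ({s..t} \<times> {-R..R}))"
    by (rule compact_imp_bounded)
  then obtain B where "\<And>z. z \<in> (\<lambda>(u, y). F u y) ` ({s..t} \<times> {-R..R}) \<Longrightarrow> \<bar>z\<bar> \<le> B"
    unfolding bounded_real by blast
  then have B: "\<bar>F u y\<bar> \<le> B" if "u \<in> {s..t}" "y \<in> {-R..R}" for u y
    using that by force
  show ?thesis
  proof (rule dominated_convergence(2)[where h="\<lambda>_. B"])
    show "(\<lambda>u. F u (X k u)) integrable_on {s..t}" for k
      by (rule integrable_continuous_real, rule comp, rule X)
    fix u assume u: "u \<in> {s..t}"
    have "X k u \<in> {-R..R}" for k
      using X(2)[of k u] u unfolding R_def by auto
    then show "norm (F u (X k u)) \<le> B" for k using B u by simp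
    have "isCont (\<lambda>(u, y). F u y) (u, x u)" using F by (simp add: continuous_on_eq_continuous_at)
    from isCont_tendsto_compose[OF this tendsto_Pair[OF tendsto_const lim]]
    show "(\<lambda>k. F u (X k u)) \<longlonglongrightarrow> F u (x u)" by simp
  qed auto
qed

section \<open>The Euler--Lagrange equation of a minimising limit\<close>

text \<open>Hat functions are the only test functions used. Pairing their slopes with the derivative
  of a curve yields difference quotients of the curve itself.\<close>

definition tent :: "real \<Rightarrow> real \<Rightarrow> real \<Rightarrow> real \<Rightarrow> real" where
  "tent \<alpha> p \<beta> t = (if t \<le> p then (if t \<le> \<alpha> then 0 else (t - \<alpha>) / (p - \<alpha>))
    else (if t \<le> \<beta> then (\<beta> - t) / (\<beta> - p) else 0))"

text \<open>At a breakpoint the slope is that of the piece to its left, which is the convention of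
  \<open>curve_splice\<close>.\<close>

definition tent_slope :: "real \<Rightarrow> real \<Rightarrow> real \<Rightarrow> real \<Rightarrow> real" where
  "tent_slope \<alpha> p \<beta> t = (if t \<le> p then (if t \<le> \<alpha> then 0 else 1 / (p - \<alpha>))
    else (if t \<le> \<beta> then - 1 / (\<beta> - p) else 0))"

lemma curve_tent:
  assumes "\<alpha> < p" "p < \<beta>"
  shows "curve (tent \<alpha> p \<beta>) (tent_slope \<alpha> p \<beta>)"
proof -
  have 1: "curve (\<lambda>t. (t - \<alpha>) / (p - \<alpha>)) (\<lambda>_. 1 / (p - \<alpha>))"
    using curve_affine[of "- \<alpha> / (p - \<alpha>)" "1 / (p - \<alpha>)"] by (simp add: diff_divide_distrib)
  have 2: "curve (\<lambda>t. (\<beta> - t) / (\<beta> - p)) (\<lambda>_. - 1 / (\<beta> - p))"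
    using curve_affine[of "\<beta> / (\<beta> - p)" "- 1 / (\<beta> - p)"] by (simp add: diff_divide_distrib)
  show ?thesis
    unfolding tent_def[abs_def] tent_slope_def[abs_def]
    by (intro curve_splice 1 2 curve_const) (use assms in auto)
qed

lemma tent_slope_zero: "\<alpha> < p \<Longrightarrow> p < \<beta> \<Longrightarrow> t < \<alpha> \<or> \<beta> < t \<Longrightarrow> tent_slope \<alpha> p \<beta> t = 0"
  by (auto simp: tent_slope_def)

lemma tent_zero: "\<alpha> < p \<Longrightarrow> p < \<beta> \<Longrightarrow> t < \<alpha> \<or> \<beta> < t \<Longrightarrow> tent \<alpha> p \<beta> t = 0"
  by (auto simp: tent_def)

text \<open>Two integrations by parts move both derivatives from \<open>H\<close> to the hat, whose
  second derivative consists of point masses at the three breakpoints; this leaves a second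
  difference of \<open>H\<close>.\<close>

lemma integral_tent_second_derivative:
  assumes p: "\<alpha> < p" "p < \<beta>"
    and H: "\<And>t. (H has_real_derivative H1 t) (at t)" "\<And>t. (H1 has_real_derivative f t) (at t)"
  shows "((\<lambda>t. f t * tent \<alpha> p \<beta> t) has_integral
    ((H \<beta> - H p) / (\<beta> - p) - (H p - H \<alpha>) / (p - \<alpha>))) {\<alpha>..\<beta>}"
proof -
  \<comment> \<open>\<open>?A\<close> and \<open>?B\<close> are antiderivatives of \<open>f\<close>
    times the rising and the falling line, each found by one integration by parts.\<close>
  let ?A = "\<lambda>t. (H1 t * (t - \<alpha>) - H t) / (p - \<alpha>)"
  let ?B = "\<lambda>t. (H1 t * (\<beta> - t) + H t) / (\<beta> - p)"
  have "((\<lambda>t. f t * tent \<alpha> p \<beta> t) has_integral (?A p - ?A \<alpha>)) {\<alpha>..p}"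
  proof (rule fundamental_theorem_of_calculus)
    fix t assume t: "t \<in> {\<alpha>..p}"
    have "(?A has_real_derivative (f t * (t - \<alpha>) / (p - \<alpha>))) (at t within {\<alpha>..p})"
      using p by (auto intro!: derivative_eq_intros DERIV_subset[OF H(1)] DERIV_subset[OF H(2)])
    moreover have "f t * (t - \<alpha>) / (p - \<alpha>) = f t * tent \<alpha> p \<beta> t" using t by (auto simp: tent_def)
    ultimately show "(?A has_vector_derivative f t * tent \<alpha> p \<beta> t) (at t within {\<alpha>..p})"
      by (simp add: has_real_derivative_iff_has_vector_derivative)
  qed (use p in simp)
  moreover have "((\<lambda>t. f t * tent \<alpha> p \<beta> t) has_integral (?B \<beta> - ?B p)) {p..\<beta>}"
  proof (rule fundamental_theorem_of_calculus)
    fix t assume t: "t \<in> {p..\<beta>}"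
    have "(?B has_real_derivative (f t * (\<beta> - t) / (\<beta> - p))) (at t within {p..\<beta>})"
      using p by (auto intro!: derivative_eq_intros DERIV_subset[OF H(1)] DERIV_subset[OF H(2)])
    moreover have "f t * (\<beta> - t) / (\<beta> - p) = f t * tent \<alpha> p \<beta> t" using t p by (auto simp: tent_def)
    ultimately show "(?B has_vector_derivative f t * tent \<alpha> p \<beta> t) (at t within {p..\<beta>})"
      by (simp add: has_real_derivative_iff_has_vector_derivative)
  qed (use p in simp)
  ultimately have "((\<lambda>t. f t * tent \<alpha> p \<beta> t) has_integral (?A p - ?A \<alpha> + (?B \<beta> - ?B p))) {\<alpha>..\<beta>}"
    by (intro has_integral_combine[of \<alpha> p \<beta>]) (use p in auto)
  moreover have "?A p - ?A \<alpha> + (?B \<beta> - ?B p) = (H \<beta> - H p) / (\<beta> - p) - (H p - H \<alpha>) / (p - \<alpha>)"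
  proof -
    have "?A p = H1 p - H p / (p - \<alpha>)" "?B p = H1 p + H p / (\<beta> - p)"
      using p by (auto simp: diff_divide_distrib add_divide_distrib)
    moreover have "?A \<alpha> = - (H \<alpha> / (p - \<alpha>))" "?B \<beta> = H \<beta> / (\<beta> - p)" by simp_all
    moreover have "(H \<beta> - H p) / (\<beta> - p) = H \<beta> / (\<beta> - p) - H p / (\<beta> - p)"
      "(H p - H \<alpha>) / (p - \<alpha>) = H p / (p - \<alpha>) - H \<alpha> / (p - \<alpha>)"
      by (rule diff_divide_distrib)+
    ultimately show ?thesis by linarith
  qed
  ultimately show ?thesis by metis
qed

lemma continuous_antiderivative:
  fixes f :: "real \<Rightarrow> real"
  assumes "continuous_on UNIV f"
  obtains F where "\<And>t. (F has_real_derivative f t) (at t)"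
proof -
  have "\<exists>F. \<forall>x::real. -\<infinity> < ereal x \<longrightarrow> ereal x < \<infinity> \<longrightarrow> (F has_vector_derivative f x) (at x)"
    by (rule einterval_antiderivative) (use assms in \<open>auto simp: continuous_on_eq_continuous_at\<close>)
  then show ?thesis using that by (auto simp: has_real_derivative_iff_has_vector_derivative)
qed

lemma affine_if_equal_slopes:
  fixes u :: "real \<Rightarrow> real"
  assumes "\<And>\<alpha> p \<beta>. \<alpha> < p \<Longrightarrow> p < \<beta> \<Longrightarrow> (u p - u \<alpha>) / (p - \<alpha>) = (u \<beta> - u p) / (\<beta> - p)"
  shows "u t = u 0 + (u 1 - u 0) * t"
proof -
  consider "t < 0" | "t = 0" | "0 < t" "t < 1" | "t = 1" | "1 < t" by linarith
  then show ?thesis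
  proof cases
    case 1
    then show ?thesis using assms[of t 0 1] by (simp add: field_simps)
  next
    case 3
    then show ?thesis using assms[of 0 t 1] by (simp add: field_simps)
  next
    case 5
    then show ?thesis using assms[of 0 1 t] by (simp add: field_simps)
  qed auto
qed

context double_well
begin

text \<open>The kinetic part expands exactly: the mixed term integrates \<open>g\<close> against
  constant slopes and so gives difference quotients of \<open>x\<close>, and the coefficient of the
  square of \<sigma> is half the integral of the squared slope. Only the potential part remains as
  an integral.\<close>

lemma action_tent_variation:
  assumes x: "transition x g" and b: "continuous_on UNIV b" and p: "\<alpha> < p" "p < \<beta>"
  shows "transition (\<lambda>t. x t + \<sigma> * tent \<alpha> p \<beta> t) (\<lambda>t. g t + \<sigma> * tent_slope \<alpha> p \<beta> t)" (is ?A)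
    and "action b (\<lambda>t. x t + \<sigma> * tent \<alpha> p \<beta> t) (\<lambda>t. g t + \<sigma> * tent_slope \<alpha> p \<beta> t) - action b x g
      = \<sigma> * ((x p - x \<alpha>) / (p - \<alpha>) - (x \<beta> - x p) / (\<beta> - p))
        + \<sigma>\<^sup>2 * ((1 / (p - \<alpha>) + 1 / (\<beta> - p)) / 2)
        + integral {\<alpha>..\<beta>} (\<lambda>u. b u * (W (x u + \<sigma> * tent \<alpha> p \<beta> u) - W (x u)))" (is "_ = ?R")
proof -
  let ?y = "\<lambda>t. x t + \<sigma> * tent \<alpha> p \<beta> t" and ?h = "\<lambda>t. g t + \<sigma> * tent_slope \<alpha> p \<beta> t"
  let ?\<psi> = "tent_slope \<alpha> p \<beta>"
  obtain S where S: "S > 0" "\<And>t. t \<le> -S \<Longrightarrow> x t = -1" "\<And>t. t \<le> -S \<Longrightarrow> g t = 0"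
    "\<And>t. t \<ge> S \<Longrightarrow> x t = 1" "\<And>t. t \<ge> S \<Longrightarrow> g t = 0"
    using transitionE[OF x] by blast
  show y: ?A
    by (rule transitionI[of _ _ "min (-S) (\<alpha> - 1)" "max S (\<beta> + 1)"])
      (use S p in \<open>auto intro: curve_add_scaled transition_curve[OF x] curve_tent simp: tent_zero tent_slope_zero\<close>)
  have a1: "((\<lambda>t. g t * ?\<psi> t) has_integral (x p - x \<alpha>) / (p - \<alpha>)) {\<alpha>..p}"
    by (rule has_integral_spike_finite[of "{\<alpha>}", OF _ _
          has_integral_divide[OF curve_has_integral[OF transition_curve[OF x]]]])
      (use p in \<open>auto simp: tent_slope_def\<close>)
  have a2: "((\<lambda>t. g t * ?\<psi> t) has_integral - ((x \<beta> - x p) / (\<beta> - p))) {p..\<beta>}"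
    by (rule has_integral_spike_finite[of "{p}", OF _ _
          has_integral_neg[OF has_integral_divide[OF curve_has_integral[OF transition_curve[OF x]]]]])
      (use p in \<open>auto simp: tent_slope_def\<close>)
  have 1: "((\<lambda>t. g t * ?\<psi> t) has_integral
      ((x p - x \<alpha>) / (p - \<alpha>) - (x \<beta> - x p) / (\<beta> - p))) {\<alpha>..\<beta>}"
    using has_integral_combine[OF _ _ a1 a2] p by simp
  have c1: "((\<lambda>t. (?\<psi> t)\<^sup>2) has_integral (p - \<alpha>) * (1 / (p - \<alpha>))\<^sup>2) {\<alpha>..p}"
    by (rule has_integral_spike_finite[of "{\<alpha>}" _ _ "\<lambda>_. (1 / (p - \<alpha>))\<^sup>2"])
      (use p has_integral_const_real[of "(1 / (p - \<alpha>))\<^sup>2" \<alpha> p] in \<open>auto simp: tent_slope_def\<close>)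
  have c2: "((\<lambda>t. (?\<psi> t)\<^sup>2) has_integral (\<beta> - p) * (1 / (\<beta> - p))\<^sup>2) {p..\<beta>}"
    by (rule has_integral_spike_finite[of "{p}" _ _ "\<lambda>_. (1 / (\<beta> - p))\<^sup>2"])
      (use p has_integral_const_real[of "(1 / (\<beta> - p))\<^sup>2" p \<beta>] in \<open>auto simp: tent_slope_def power_divide\<close>)
  have "((\<lambda>t. (?\<psi> t)\<^sup>2) has_integral
      ((p - \<alpha>) * (1 / (p - \<alpha>))\<^sup>2 + (\<beta> - p) * (1 / (\<beta> - p))\<^sup>2)) {\<alpha>..\<beta>}"
    using has_integral_combine[OF _ _ c1 c2] p by simp
  then have 2: "((\<lambda>t. (?\<psi> t)\<^sup>2) has_integral (1 / (p - \<alpha>) + 1 / (\<beta> - p))) {\<alpha>..\<beta>}"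
    using p by (simp add: power2_eq_square)
  have "(\<lambda>u. b u * (W (?y u) - W (x u))) integrable_on {\<alpha>..\<beta>}"
    by (intro integrable_continuous_real continuous_intros W_cont_comp curve_continuous[OF transition_curve[OF x]]
        curve_continuous[OF curve_tent[OF p]] continuous_on_subset[OF b]) auto
  note 3 = integrable_integral[OF this]
  have "((\<lambda>t. \<sigma> * (g t * ?\<psi> t) + \<sigma>\<^sup>2 * ((?\<psi> t)\<^sup>2 / 2) + b t * (W (?y t) - W (x t))) has_integral ?R) {\<alpha>..\<beta>}"
    by (intro has_integral_add has_integral_mult_right has_integral_divide 1 2 3)
  moreover have "\<sigma> * (g t * ?\<psi> t) + \<sigma>\<^sup>2 * ((?\<psi> t)\<^sup>2 / 2) + b t * (W (?y t) - W (x t))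
      = lagrangian b ?y ?h t - lagrangian b x g t" for t
    by (simp add: lagrangian_def power2_eq_square field_simps)
  ultimately have "((\<lambda>t. lagrangian b ?y ?h t - lagrangian b x g t) has_integral ?R) {\<alpha>..\<beta>}"
    by simp
  then have "((\<lambda>t. lagrangian b ?y ?h t - lagrangian b x g t) has_integral ?R) UNIV"
    by (rule has_integral_on_superset) (use p in \<open>auto simp: lagrangian_def tent_zero tent_slope_zero\<close>)
  moreover have "((\<lambda>t. lagrangian b ?y ?h t - lagrangian b x g t) has_integral (action b ?y ?h - action b x g)) UNIV"
    by (intro has_integral_diff action_UNIV x y b)
  ultimately show "action b ?y ?h - action b x g = ?R"
    using has_integral_unique by blast
qed

text \<open>Every member of the sequence is minimal up to an error tending to 0, so in the limit the
  variation \<open>\<Phi> x\<close> is nonnegative for every \<sigma>. It vanishes at 0, which is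
  thus a minimum, and its derivative there is the left-hand side. The limit \<open>x\<close> itself
  is not assumed to be a transition.\<close>

lemma minimizing_limit_weak_equation:
  assumes b: "continuous_on UNIV b" "\<And>t. 0 \<le> b t"
    and X: "\<And>n::nat. transition (X n) (G n)" "(\<lambda>n. action b (X n) (G n)) \<longlonglongrightarrow> level b"
      "\<And>n t. \<bar>X n t\<bar> \<le> A + \<bar>t\<bar>"
    and x: "\<And>t. (\<lambda>n. X n t) \<longlonglongrightarrow> x t" "continuous_on UNIV x"
    and p: "\<alpha> < p" "p < \<beta>"
  shows "(x p - x \<alpha>) / (p - \<alpha>) - (x \<beta> - x p) / (\<beta> - p)
    + integral {\<alpha>..\<beta>} (\<lambda>u. b u * w (x u) * tent \<alpha> p \<beta> u) = 0"
proof -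
  let ?\<phi> = "tent \<alpha> p \<beta>"
  define E where "E = (1 / (p - \<alpha>) + 1 / (\<beta> - p)) / 2"
  define I where "I y \<sigma> = integral {\<alpha>..\<beta>} (\<lambda>u. b u * (W (y u + \<sigma> * ?\<phi> u) - W (y u)))" for y \<sigma>
  define \<Phi> where "\<Phi> y \<sigma> = \<sigma> * ((y p - y \<alpha>) / (p - \<alpha>) - (y \<beta> - y p) / (\<beta> - p)) + \<sigma>\<^sup>2 * E + I y \<sigma>" for y \<sigma>
  have \<phi>: "continuous_on B ?\<phi>" for B using curve_continuous[OF curve_tent[OF p]] .
  \<comment> \<open>The varied curve is again a transition, so its action is at least
    \<open>level b\<close>.\<close>
  have "level b - action b (X n) (G n) \<le> \<Phi> (X n) \<sigma>" for n \<sigma>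
    using level_le[OF action_tent_variation(1)[OF X(1)[of n] b(1) p, of \<sigma>], where b=b, OF b(2)]
      action_tent_variation(2)[OF X(1)[of n] b(1) p, of \<sigma>]
    unfolding \<Phi>_def I_def E_def by simp
  moreover have "(\<lambda>n. \<Phi> (X n) \<sigma>) \<longlonglongrightarrow> \<Phi> x \<sigma>" for \<sigma>
  proof -
    have "(\<lambda>n. I (X n) \<sigma>) \<longlonglongrightarrow> I x \<sigma>"
      unfolding I_def
    proof (rule integral_pointwise_limit[where F="\<lambda>u y. b u * (W (y + \<sigma> * ?\<phi> u) - W y)"])
      show "continuous_on UNIV (\<lambda>(u, y). b u * (W (y + \<sigma> * ?\<phi> u) - W y))"
        unfolding case_prod_beta
        by (intro continuous_intros W_cont_comp continuous_on_compose2[OF b(1)] continuous_on_compose2[OF \<phi>]) auto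
    qed (use X x curve_continuous transition_curve in blast)+
    then show ?thesis unfolding \<Phi>_def using p by (intro tendsto_intros x) auto
  qed
  moreover have lev: "(\<lambda>n. level b - action b (X n) (G n)) \<longlonglongrightarrow> level b - level b"
    by (intro tendsto_intros X)
  ultimately have "level b - level b \<le> \<Phi> x \<sigma>" for \<sigma>
    using LIMSEQ_le[OF lev, of "\<lambda>n. \<Phi> (X n) \<sigma>"] by blast
  then have pos: "0 \<le> \<Phi> x \<sigma>" for \<sigma> by simp
  have zero: "\<Phi> x 0 = 0" by (simp add: \<Phi>_def I_def)
  have "(I x has_real_derivative integral {\<alpha>..\<beta>} (\<lambda>u. b u * (w (x u + 0 * ?\<phi> u) * ?\<phi> u))) (at 0 within UNIV)"
    unfolding I_def cbox_interval[symmetric]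
  proof (rule leibniz_rule_field_derivative[where fx="\<lambda>\<sigma> u. b u * (w (x u + \<sigma> * ?\<phi> u) * ?\<phi> u)"])
    fix \<sigma> t :: real
    show "((\<lambda>\<sigma>. b t * (W (x t + \<sigma> * ?\<phi> t) - W (x t))) has_field_derivative b t * (w (x t + \<sigma> * ?\<phi> t) * ?\<phi> t)) (at \<sigma> within UNIV)"
      by (auto intro!: derivative_eq_intros DERIV_chain2[OF W_deriv])
    show "(\<lambda>u. b u * (W (x u + \<sigma> * ?\<phi> u) - W (x u))) integrable_on cbox \<alpha> \<beta>"
      unfolding cbox_interval
      by (intro integrable_continuous_real continuous_intros W_cont_comp continuous_on_subset[OF x(2)] \<phi>
          continuous_on_subset[OF b(1)]) auto
    show "continuous_on (UNIV \<times> cbox \<alpha> \<beta>) (\<lambda>(\<sigma>, u). b u * (w (x u + \<sigma> * ?\<phi> u) * ?\<phi> u))"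
      unfolding case_prod_beta
      by (intro continuous_intros continuous_on_compose2[OF w_cont] continuous_on_compose2[OF x(2)]
          continuous_on_compose2[OF b(1)] continuous_on_compose2[OF \<phi>]) auto
  qed auto
  then have "(\<Phi> x has_real_derivative ((x p - x \<alpha>) / (p - \<alpha>) - (x \<beta> - x p) / (\<beta> - p)
      + integral {\<alpha>..\<beta>} (\<lambda>u. b u * w (x u) * ?\<phi> u))) (at 0)"
    unfolding \<Phi>_def by (auto intro!: derivative_eq_intros simp: mult.assoc)
  from DERIV_local_min[OF this zero_less_one] show ?thesis using pos zero by simp
qed

text \<open>The argument of du Bois-Reymond: if \<open>H\<close> has second derivative
  \<open>b t * w (x t)\<close>, the weak equation says that \<open>x - H\<close> has equal slopes on
  adjacent intervals. It is therefore affine, and \<open>x\<close> is as smooth as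
  \<open>H\<close>.\<close>

lemma minimizing_limit_ode:
  assumes b: "continuous_on UNIV b" "\<And>t. 0 \<le> b t"
    and X: "\<And>n::nat. transition (X n) (G n)" "(\<lambda>n. action b (X n) (G n)) \<longlonglongrightarrow> level b"
      "\<And>n t. \<bar>X n t\<bar> \<le> A + \<bar>t\<bar>"
    and x: "\<And>t. (\<lambda>n. X n t) \<longlonglongrightarrow> x t" "continuous_on UNIV x"
  obtains v where "\<And>t. (x has_real_derivative v t) (at t)" "\<And>t. (v has_real_derivative b t * w (x t)) (at t)"
proof -
  define f where "f t = b t * w (x t)" for t
  have "continuous_on UNIV f"
    unfolding f_def by (intro continuous_intros b continuous_on_compose2[OF w_cont] x) auto
  then obtain H1 where H1: "\<And>t. (H1 has_real_derivative f t) (at t)"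
    using continuous_antiderivative by blast
  then have "continuous_on UNIV H1"
    using DERIV_isCont continuous_at_imp_continuous_on by blast
  then obtain H where H: "\<And>t. (H has_real_derivative H1 t) (at t)"
    using continuous_antiderivative by blast
  define u where "u t = x t - H t" for t
  have "(u p - u \<alpha>) / (p - \<alpha>) = (u \<beta> - u p) / (\<beta> - p)" if p: "\<alpha> < p" "p < \<beta>" for \<alpha> p \<beta>
    using minimizing_limit_weak_equation[OF b X x p]
      integral_unique[OF integral_tent_second_derivative[OF p H H1]]
    unfolding f_def[symmetric] u_def by (simp add: diff_divide_distrib)
  from affine_if_equal_slopes[of u, OF this]
  have "x t = H t + (u 0 + (u 1 - u 0) * t)" for t unfolding u_def by (simp add: algebra_simps)
  then have xe: "x = (\<lambda>t. H t + (u 0 + (u 1 - u 0) * t))" by blast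
  show ?thesis
  proof (rule that)
    show "(x has_real_derivative (H1 t + (u 1 - u 0))) (at t)" for t
      by (subst xe) (auto intro!: derivative_eq_intros H)
    show "((\<lambda>t. H1 t + (u 1 - u 0)) has_real_derivative b t * w (x t)) (at t)" for t
      using H1[of t] unfolding f_def by (auto intro!: derivative_eq_intros)
  qed
qed

section \<open>Limits of curves with finite potential integral\<close>

text \<open>By Hoelder continuity an excursion to distance \<delta> from both wells keeps distance
  \<open>\<delta>/2\<close> for a time \<rho> and costs at least \<open>\<mu> * \<rho>\<close>. Once
  less than this amount is left, no excursion can occur. Late values within 1/2 of the wells cannot
  be 0, so the sign is eventually fixed and selects the well.\<close>

lemma finite_potential_limit_at_top:
  assumes hoe: "\<And>s t. (x t - x s)\<^sup>2 \<le> C * \<bar>t - s\<bar>"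
    and fin: "\<And>T. integral {0..T} (\<lambda>t. W (x t)) \<le> M"
  shows "(x \<longlongrightarrow> 1) at_top \<or> (x \<longlongrightarrow> -1) at_top"
proof -
  have C: "C \<ge> 0" using order_trans[OF zero_le_power2 hoe[of 1 0]] by simp
  have cx: "continuous_on A x" for A using hoelder_continuous[OF hoe] .
  have int: "(\<lambda>t. W (x t)) integrable_on {s..t}" for s t
    by (intro integrable_continuous_real W_cont_comp cx)
  define I where "I T = integral {0..T} (\<lambda>t. W (x t))" for T
  have near: "\<exists>T. \<forall>t\<ge>T. \<bar>x t - 1\<bar> < \<delta> \<or> \<bar>x t + 1\<bar> < \<delta>" if \<delta>: "\<delta> > 0" for \<delta>
  proof -
    obtain \<mu> where \<mu>: "\<mu> > 0" "\<And>y. \<delta>/2 \<le> \<bar>y - 1\<bar> \<Longrightarrow> \<delta>/2 \<le> \<bar>y + 1\<bar> \<Longrightarrow> \<mu> \<le> W y"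
      using W_away[of "\<delta>/2"] \<delta> by auto
    \<comment> \<open>Chosen so that within time \<rho> the curve moves by at most
      \<open>\<delta>/2\<close>.\<close>
    define \<rho> where "\<rho> = (\<delta>/2)\<^sup>2 / (C + 1)"
    have \<rho>: "\<rho> > 0" using \<delta> C unfolding \<rho>_def by simp
    have bdd: "bdd_above (I ` {0..})" unfolding bdd_above_def I_def using fin by blast
    \<comment> \<open>From \<open>T\<close> on, the potential still to be paid is less than
      \<open>\<mu> * \<rho>\<close>.\<close>
    have "\<exists>T\<in>{0..}. Sup (I ` {0..}) - \<mu> * \<rho> < I T"
      using less_cSupD[of "I ` {0..}" "Sup (I ` {0..}) - \<mu> * \<rho>"] \<mu> \<rho> by auto
    then obtain T where T: "T \<ge> 0" "Sup (I ` {0..}) < I T + \<mu> * \<rho>" by auto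
    have "\<bar>x t - 1\<bar> < \<delta> \<or> \<bar>x t + 1\<bar> < \<delta>" if t: "t \<ge> T" for t
    proof (rule ccontr)
      assume neg: "\<not> ?thesis"
      have "integral {t..t+\<rho>} (\<lambda>_. \<mu>) \<le> integral {t..t+\<rho>} (\<lambda>t. W (x t))"
      proof (rule integral_le)
        fix s assume s: "s \<in> {t..t+\<rho>}"
        have "(x s - x t)\<^sup>2 \<le> C * \<bar>s - t\<bar>" by (rule hoe)
        also have "\<dots> \<le> (C + 1) * \<rho>" using s C by (intro mult_mono) auto
        also have "\<dots> = (\<delta>/2)\<^sup>2" using C unfolding \<rho>_def by simp
        finally have "\<bar>x s - x t\<bar> \<le> \<delta>/2" using abs_le_square_iff[of "x s - x t" "\<delta>/2"] \<delta> by simp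
        then show "\<mu> \<le> W (x s)" using neg by (intro \<mu>(2)) linarith+
      qed (use int in auto)
      then have "\<mu> * \<rho> \<le> integral {t..t+\<rho>} (\<lambda>t. W (x t))" using \<rho> by (simp add: mult.commute)
      moreover have "I T + integral {T..t} (\<lambda>t. W (x t)) = I t"
        unfolding I_def by (rule Henstock_Kurzweil_Integration.integral_combine) (use T t int in auto)
      moreover have "I t + integral {t..t+\<rho>} (\<lambda>t. W (x t)) = I (t + \<rho>)"
        unfolding I_def by (rule Henstock_Kurzweil_Integration.integral_combine) (use T t int \<rho> in auto)
      moreover have "0 \<le> integral {T..t} (\<lambda>t. W (x t))" by (rule integral_nonneg[OF int]) (rule W_nonneg)
      moreover have "I (t + \<rho>) \<le> Sup (I ` {0..})" by (rule cSUP_upper) (use bdd T t \<rho> in auto)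
      ultimately show False using T by linarith
    qed
    then show ?thesis by blast
  qed
  obtain T where T: "\<And>t. t \<ge> T \<Longrightarrow> \<bar>x t - 1\<bar> < 1/2 \<or> \<bar>x t + 1\<bar> < 1/2" using near[of "1/2"] by auto
  have nz: "x t \<noteq> 0" if "t \<ge> T" for t using T[OF that] by auto
  show ?thesis
  proof (cases "x T > 0")
    case True
    have pos: "x t > 0" if "t \<ge> T" for t
    proof (rule ccontr)
      assume "\<not> x t > 0"
      then obtain s where "T \<le> s" "s \<le> t" "x s = 0" using IVT2'[of x t 0 T] cx True \<open>t \<ge> T\<close> by auto
      then show False using nz by blast
    qed
    have "(x \<longlongrightarrow> 1) at_top"
    proof (rule tendstoI)
      fix e :: real assume e: "e > 0"
      obtain T' where T': "\<And>t. t \<ge> T' \<Longrightarrow> \<bar>x t - 1\<bar> < min e (1/2) \<or> \<bar>x t + 1\<bar> < min e (1/2)"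
        using near[of "min e (1/2)"] e by auto
      have "dist (x t) 1 < e" if "t \<ge> max T T'" for t
        using T'[of t] pos[of t] that by (auto simp: dist_real_def)
      then show "\<forall>\<^sub>F t in at_top. dist (x t) 1 < e" unfolding eventually_at_top_linorder by blast
    qed
    then show ?thesis ..
  next
    case False
    have neg: "x t < 0" if "t \<ge> T" for t
    proof (rule ccontr)
      assume "\<not> x t < 0"
      then obtain s where "T \<le> s" "s \<le> t" "x s = 0" using IVT'[of x T 0 t] cx False \<open>t \<ge> T\<close> by auto
      then show False using nz by blast
    qed
    have "(x \<longlongrightarrow> -1) at_top"
    proof (rule tendstoI)
      fix e :: real assume e: "e > 0"
      obtain T' where T': "\<And>t. t \<ge> T' \<Longrightarrow> \<bar>x t - 1\<bar> < min e (1/2) \<or> \<bar>x t + 1\<bar> < min e (1/2)"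
        using near[of "min e (1/2)"] e by auto
      have "dist (x t) (-1) < e" if "t \<ge> max T T'" for t
        using T'[of t] neg[of t] that by (auto simp: dist_real_def)
      then show "\<forall>\<^sub>F t in at_top. dist (x t) (-1) < e" unfolding eventually_at_top_linorder by blast
    qed
    then show ?thesis ..
  qed
qed

lemma finite_potential_limits:
  assumes hoe: "\<And>s t. (x t - x s)\<^sup>2 \<le> C * \<bar>t - s\<bar>"
    and fin: "\<And>s t. integral {s..t} (\<lambda>t. W (x t)) \<le> M"
  shows "(x \<longlongrightarrow> 1) at_top \<or> (x \<longlongrightarrow> -1) at_top" "(x \<longlongrightarrow> 1) at_bot \<or> (x \<longlongrightarrow> -1) at_bot"
proof -
  show "(x \<longlongrightarrow> 1) at_top \<or> (x \<longlongrightarrow> -1) at_top"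
    by (rule finite_potential_limit_at_top[OF hoe fin])
  have "(x (- t) - x (- s))\<^sup>2 \<le> C * \<bar>t - s\<bar>" for s t using hoe[of "-t" "-s"] by (simp add: abs_minus_commute)
  moreover have "integral {0..T} (\<lambda>t. W (x (- t))) \<le> M" for T
    using fin[of "-T" 0] Henstock_Kurzweil_Integration.integral_reflect_real[of 0 "-T" "\<lambda>t. W (x t)"] by simp
  ultimately show "(x \<longlongrightarrow> 1) at_bot \<or> (x \<longlongrightarrow> -1) at_bot"
    unfolding filterlim_at_bot_mirror by (rule finite_potential_limit_at_top)
qed

section \<open>Excluding escape to infinity\<close>

lemma potential_continuous:
  assumes "continuous_on UNIV b" "continuous_on UNIV x"
  shows "continuous_on A (\<lambda>t. b t * W (x t))"
  by (intro continuous_intros W_cont_comp continuous_on_subset[OF assms(1)] continuous_on_subset[OF assms(2)]) auto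

lemma potential_limit:
  assumes b: "continuous_on UNIV b"
    and X: "\<And>n::nat. transition (X n) (G n)" "\<And>n t. \<bar>X n t\<bar> \<le> A + \<bar>t\<bar>"
    and lim: "\<And>t. (\<lambda>n. X n t) \<longlonglongrightarrow> x t"
  shows "(\<lambda>n. integral {s..t} (\<lambda>u. b u * W (X n u))) \<longlonglongrightarrow> integral {s..t} (\<lambda>u. b u * W (x u))"
proof (rule integral_pointwise_limit[where F="\<lambda>u y. b u * W y", OF _ _ X(2) lim])
  show "continuous_on UNIV (\<lambda>(u, y). b u * W y)"
    unfolding case_prod_beta
    by (intro continuous_intros W_cont_comp continuous_on_compose2[OF b]) auto
qed (use X(1) curve_continuous transition_curve in blast)

text \<open>The confinement to (-1, 1) is left out here and supplied by
  \<open>heteroclinic_het_sol\<close>.\<close>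

definition heteroclinic :: "(real \<Rightarrow> real) \<Rightarrow> (real \<Rightarrow> real) \<Rightarrow> (real \<Rightarrow> real) \<Rightarrow> bool" where
  "heteroclinic b x v \<longleftrightarrow> (\<forall>t. (x has_real_derivative v t) (at t))
     \<and> (\<forall>t. (v has_real_derivative b t * w (x t)) (at t))
     \<and> (x \<longlongrightarrow> -1) at_bot \<and> (x \<longlongrightarrow> 1) at_top"

text \<open>Collects what holds for every continuous weight bounded below by a positive constant.
  The limit may still rest in a well or have a wrong end. Excluding this means comparing it with the
  curves that produced it, so the sequence is returned as well.\<close>

lemma minimizing_sequence:
  assumes b: "continuous_on UNIV b" "0 < c" "\<And>t. c \<le> b t"
  obtains X G x v A where
    "\<And>n::nat. transition (X n) (G n)" "\<And>n. action b (X n) (G n) < level b + 1 / (real n + 1)"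
    "\<And>n t. \<bar>X n t\<bar> \<le> A + \<bar>t\<bar>" "\<And>t. (\<lambda>n. X n t) \<longlonglongrightarrow> x t"
    "\<And>t. (x has_real_derivative v t) (at t)" "\<And>t. (v has_real_derivative b t * w (x t)) (at t)"
    "(x \<longlongrightarrow> 1) at_top \<or> (x \<longlongrightarrow> -1) at_top" "(x \<longlongrightarrow> 1) at_bot \<or> (x \<longlongrightarrow> -1) at_bot"
proof -
  have b0: "0 \<le> b t" for t using b(2) b(3)[of t] by linarith
  define M where "M = level b + 1"
  have "\<forall>n::nat. \<exists>x g. transition x g \<and> action b x g < level b + 1 / (real n + 1)"
  proof
    fix n :: nat
    show "\<exists>x g. transition x g \<and> action b x g < level b + 1 / (real n + 1)"
      by (rule level_approx[of "1 / (real n + 1)" b]) auto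
  qed
  then obtain Y H where Y: "\<And>n::nat. transition (Y n) (H n)"
    "\<And>n. action b (Y n) (H n) < level b + 1 / (real n + 1)" by metis
  have YM: "action b (Y n) (H n) \<le> M" for n
  proof -
    have "1 / (real n + 1) \<le> 1" by simp
    then show ?thesis using Y(2)[of n] unfolding M_def by linarith
  qed
  obtain r x where r: "strict_mono r" and x: "\<And>t. (\<lambda>n. Y (r n) t) \<longlonglongrightarrow> x t"
    and hoe: "\<And>s t. (x t - x s)\<^sup>2 \<le> 2 * M * \<bar>t - s\<bar>"
    by (rule transitions_convergent_subsequence[OF b Y(1) YM]) (rule that; assumption)
  obtain A where A: "\<And>n t. \<bar>Y n t\<bar> \<le> A + \<bar>t\<bar>"
    using transitions_locally_bounded[OF b, of M] Y(1) YM by blast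
  define X where "X n = Y (r n)" for n
  define G where "G n = H (r n)" for n
  have X: "\<And>n. transition (X n) (G n)" "\<And>n t. \<bar>X n t\<bar> \<le> A + \<bar>t\<bar>" "\<And>t. (\<lambda>n. X n t) \<longlonglongrightarrow> x t"
    using Y(1) A x unfolding X_def G_def by auto
  have XM: "action b (X n) (G n) < level b + 1 / (real n + 1)" for n
  proof -
    \<comment> \<open>The rate of the original sequence survives the passage to the subsequence
      because \<open>n \<le> r n\<close>.\<close>
    have "1 / (real (r n) + 1) \<le> 1 / (real n + 1)"
      using seq_suble[OF r, of n] by (intro divide_left_mono) auto
    then show ?thesis using Y(2)[of "r n"] unfolding X_def G_def by linarith
  qed
  have conv: "(\<lambda>n. action b (X n) (G n)) \<longlonglongrightarrow> level b"
  proof (rule tendsto_sandwich[of "\<lambda>_. level b" _ _ "\<lambda>n. level b + 1 / (real n + 1)"])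
    show "(\<lambda>n. level b + 1 / (real n + 1)) \<longlonglongrightarrow> level b"
      using tendsto_add[OF tendsto_const[of "level b"] LIMSEQ_inverse_real_of_nat]
      by (simp add: inverse_eq_divide add.commute)
    show "\<forall>\<^sub>F n in sequentially. level b \<le> action b (X n) (G n)"
      using level_le[OF X(1), where b=b, OF b0] by simp
    show "\<forall>\<^sub>F n in sequentially. action b (X n) (G n) \<le> level b + 1 / (real n + 1)"
      using XM by (auto intro!: always_eventually less_imp_le)
  qed simp
  have cx: "continuous_on B x" for B by (rule hoelder_continuous[OF hoe])
  have fin: "integral {s..t} (\<lambda>t. W (x t)) \<le> M / c" for s t
  proof -
    have "integral {s..t} (\<lambda>u. b u * W (x u)) \<le> M"
    proof (rule LIMSEQ_le_const2[OF potential_limit[OF b(1) X]])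
      show "\<exists>N. \<forall>n\<ge>N. integral {s..t} (\<lambda>u. b u * W (X n u)) \<le> M"
        using order_trans[OF integral_potential_le_action[OF Y(1) b(1) b0] YM] unfolding X_def by blast
    qed
    moreover have "integral {s..t} (\<lambda>u. c * W (x u)) \<le> integral {s..t} (\<lambda>u. b u * W (x u))"
    proof (rule integral_le)
      show "(\<lambda>u. c * W (x u)) integrable_on {s..t}"
        by (intro integrable_continuous_real continuous_intros W_cont_comp cx)
      show "(\<lambda>u. b u * W (x u)) integrable_on {s..t}"
        by (intro integrable_continuous_real potential_continuous b cx)
    qed (use b(3) W_nonneg in \<open>auto intro: mult_right_mono\<close>)
    ultimately show ?thesis using b(2) by (simp add: field_simps)
  qed
  obtain v where "\<And>t. (x has_real_derivative v t) (at t)" "\<And>t. (v has_real_derivative b t * w (x t)) (at t)"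
    using minimizing_limit_ode[OF b(1) b0 X(1) conv X(2,3) cx] by blast
  with X XM finite_potential_limits[OF hoe fin] show ?thesis using that by blast
qed

text \<open>If the curve is close to 1 at time \<open>s\<close>, a competitor can run straight to 1
  in unit time and stay there. This costs at most \<open>d\<^sup>2 / 2 + B * \<kappa>\<close> and
  saves whatever potential was paid later.\<close>

lemma cut_right_tail:
  assumes X: "transition x g" and b: "continuous_on UNIV b" "\<And>t. 0 \<le> b t" "\<And>t. b t \<le> B"
    and d: "\<bar>x s - 1\<bar> \<le> d" "\<And>y. \<bar>y - 1\<bar> \<le> d \<Longrightarrow> W y \<le> \<kappa>" and p: "s \<le> p"
  shows "level b \<le> action b x g - integral {p..q} (\<lambda>t. b t * W (x t)) + (d\<^sup>2 / 2 + B * \<kappa>)"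
proof -
  \<comment> \<open>The middle piece is \<open>x s + (1 - x s) * (t - s)\<close>, written in the
    form of \<open>curve_affine\<close>.\<close>
  define y where "y t = (if t \<le> s then x t else if t \<le> s + 1 then (x s - (1 - x s) * s) + (1 - x s) * t else 1)" for t
  define h where "h t = (if t \<le> s then g t else if t \<le> s + 1 then 1 - x s else 0)" for t
  obtain S where S: "S > 0" "\<And>t. t \<le> -S \<Longrightarrow> x t = -1" "\<And>t. t \<le> -S \<Longrightarrow> g t = 0"
    "\<And>t. t \<ge> S \<Longrightarrow> x t = 1" "\<And>t. t \<ge> S \<Longrightarrow> g t = 0"
    using transitionE[OF X] by blast
  have "curve y h"
    unfolding y_def[abs_def] h_def[abs_def]
    by (intro curve_splice curve_affine curve_const transition_curve[OF X]) (auto simp: algebra_simps)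
  then have y: "transition y h"
    by (rule transitionI[where p="min s (-S)" and q="s + 2"]) (use S in \<open>auto simp: y_def h_def\<close>)
  have \<kappa>: "0 \<le> \<kappa>" using order_trans[OF W_nonneg d(2)[of 1]] order_trans[OF abs_ge_zero d(1)] by simp
  have B: "0 \<le> B" using b(2,3)[of 0] by linarith
  define K where "K = d\<^sup>2 / 2 + B * \<kappa>"
  have pot: "(\<lambda>t. b t * W (x t)) integrable_on {p..q}"
    by (intro integrable_continuous_real potential_continuous b curve_continuous[OF transition_curve[OF X]])
  \<comment> \<open>This integrand dominates the Lagrangian of the competitor pointwise: the saving
    on \<open>{p..q}\<close> is removed, and the price \<open>K\<close> is spread over the unit
    interval of the straight run.\<close>
  have I: "((\<lambda>t. lagrangian b x g t - (if t \<in> {p..q} then b t * W (x t) else 0) + (if t \<in> {s..s+1} then K else 0))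
      has_integral (action b x g - integral {p..q} (\<lambda>t. b t * W (x t)) + K)) UNIV"
    using has_integral_const_real[of K s "s + 1"]
    by (intro has_integral_add has_integral_diff action_UNIV X b
        has_integral_restrict_UNIV[THEN iffD2] integrable_integral[OF pot]) simp
  have "action b y h \<le> action b x g - integral {p..q} (\<lambda>t. b t * W (x t)) + K"
  proof (rule has_integral_le[OF action_UNIV[OF y b(1)] I])
    fix t
    have near: "b t * W z \<le> B * \<kappa>" if "\<bar>z - 1\<bar> \<le> d" for z
      using d(2)[OF that] b(2,3)[of t] W_nonneg[of z] B by (intro mult_mono) auto
    have L: "b t * W (x t) \<le> lagrangian b x g t" by (simp add: lagrangian_def)
    have bW: "0 \<le> b t * W (x t)" using b(2) W_nonneg by simp
    have K: "0 \<le> K" using B \<kappa> by (simp add: K_def)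
    consider "t < s" | "t = s" | "s < t" "t \<le> s + 1" | "t > s + 1" by linarith
    then show "lagrangian b y h t \<le> lagrangian b x g t - (if t \<in> {p..q} then b t * W (x t) else 0) + (if t \<in> {s..s+1} then K else 0)"
    proof cases
      case 1
      then show ?thesis using p by (simp add: lagrangian_def y_def h_def)
    next
      \<comment> \<open>At \<open>s\<close> the competitor still has slope \<open>g s\<close> and
        value \<open>x s\<close>. Since \<open>p = s\<close> is possible, the potential subtracted
        there has to be covered by \<open>K\<close>.\<close>
      case 2
      have "b s * W (x s) \<le> K" unfolding K_def using near[of "x s"] d(1) 2 by (simp add: add_increasing)
      then show ?thesis using 2 K by (auto simp: lagrangian_def y_def h_def)
    next
      case 3
      have e: "y t - 1 = (x s - 1) * (1 - (t - s))" using 3 by (simp add: y_def algebra_simps)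
      have "\<bar>y t - 1\<bar> \<le> \<bar>x s - 1\<bar> * 1"
        unfolding e abs_mult using 3 by (intro mult_left_mono) auto
      then have "b t * W (y t) \<le> B * \<kappa>" using near d(1) by simp
      moreover have "(h t)\<^sup>2 \<le> d\<^sup>2" using 3 d(1) abs_le_square_iff[of "h t" d] by (simp add: h_def abs_minus_commute)
      ultimately have "lagrangian b y h t \<le> K" by (simp add: lagrangian_def K_def)
      then show ?thesis using 3 L bW by auto
    next
      case 4
      then have "lagrangian b y h t = 0" using W_zero by (simp add: lagrangian_def y_def h_def)
      then show ?thesis using 4 L bW by auto
    qed
  qed
  then show ?thesis using level_le[OF y, where b=b, OF b(2)] unfolding K_def by linarith
qed

text \<open>The same surgery at the other end: near -1 at time \<open>s\<close>, everything before
  \<open>s\<close> is replaced. Time reversal turns a transition into a curve from 1 to -1, so this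
  is not an instance of \<open>cut_right_tail\<close>.\<close>

lemma cut_left_tail:
  assumes X: "transition x g" and b: "continuous_on UNIV b" "\<And>t. 0 \<le> b t" "\<And>t. b t \<le> B"
    and d: "\<bar>x s + 1\<bar> \<le> d" "\<And>y. \<bar>y + 1\<bar> \<le> d \<Longrightarrow> W y \<le> \<kappa>" and q: "q \<le> s"
  shows "level b \<le> action b x g - integral {p..q} (\<lambda>t. b t * W (x t)) + (d\<^sup>2 / 2 + B * \<kappa>)"
proof -
  define y where "y t = (if t \<le> s then if t \<le> s - 1 then -1 else (x s - (x s + 1) * s) + (x s + 1) * t else x t)" for t
  define h where "h t = (if t \<le> s then if t \<le> s - 1 then 0 else x s + 1 else g t)" for t
  obtain S where S: "S > 0" "\<And>t. t \<le> -S \<Longrightarrow> x t = -1" "\<And>t. t \<le> -S \<Longrightarrow> g t = 0"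
    "\<And>t. t \<ge> S \<Longrightarrow> x t = 1" "\<And>t. t \<ge> S \<Longrightarrow> g t = 0"
    using transitionE[OF X] by blast
  have "curve y h"
    unfolding y_def[abs_def] h_def[abs_def]
    by (intro curve_splice curve_affine curve_const transition_curve[OF X]) (auto simp: algebra_simps)
  then have y: "transition y h"
    by (rule transitionI[where p="s - 1" and q="max (s + 1) S"]) (use S in \<open>auto simp: y_def h_def\<close>)
  have \<kappa>: "0 \<le> \<kappa>" using order_trans[OF W_nonneg d(2)[of "-1"]] order_trans[OF abs_ge_zero d(1)] by simp
  have B: "0 \<le> B" using b(2,3)[of 0] by linarith
  define K where "K = d\<^sup>2 / 2 + B * \<kappa>"
  have pot: "(\<lambda>t. b t * W (x t)) integrable_on {p..q}"
    by (intro integrable_continuous_real potential_continuous b curve_continuous[OF transition_curve[OF X]])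
  have I: "((\<lambda>t. lagrangian b x g t - (if t \<in> {p..q} then b t * W (x t) else 0) + (if t \<in> {s-1..s} then K else 0))
      has_integral (action b x g - integral {p..q} (\<lambda>t. b t * W (x t)) + K)) UNIV"
    using has_integral_const_real[of K "s - 1" s]
    by (intro has_integral_add has_integral_diff action_UNIV X b
        has_integral_restrict_UNIV[THEN iffD2] integrable_integral[OF pot]) simp
  have "action b y h \<le> action b x g - integral {p..q} (\<lambda>t. b t * W (x t)) + K"
  proof (rule has_integral_le[OF action_UNIV[OF y b(1)] I])
    fix t
    have near: "b t * W z \<le> B * \<kappa>" if "\<bar>z + 1\<bar> \<le> d" for z
      using d(2)[OF that] b(2,3)[of t] W_nonneg[of z] B by (intro mult_mono) auto
    have L: "b t * W (x t) \<le> lagrangian b x g t" by (simp add: lagrangian_def)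
    have bW: "0 \<le> b t * W (x t)" using b(2) W_nonneg by simp
    consider "t > s" | "s - 1 < t" "t \<le> s" | "t \<le> s - 1" by linarith
    then show "lagrangian b y h t \<le> lagrangian b x g t - (if t \<in> {p..q} then b t * W (x t) else 0) + (if t \<in> {s-1..s} then K else 0)"
    proof cases
      case 1
      then show ?thesis using q by (simp add: lagrangian_def y_def h_def)
    next
      case 2
      have e: "y t + 1 = (x s + 1) * (1 - (s - t))" using 2 by (simp add: y_def algebra_simps)
      have "\<bar>y t + 1\<bar> \<le> \<bar>x s + 1\<bar> * 1"
        unfolding e abs_mult using 2 by (intro mult_left_mono) auto
      then have "b t * W (y t) \<le> B * \<kappa>" using near d(1) by simp
      moreover have "(h t)\<^sup>2 \<le> d\<^sup>2" using 2 d(1) abs_le_square_iff[of "h t" d] by (simp add: h_def)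
      ultimately have "lagrangian b y h t \<le> K" by (simp add: lagrangian_def K_def)
      then show ?thesis using 2 L bW by auto
    next
      case 3
      then have "lagrangian b y h t = 0" using W_zero by (simp add: lagrangian_def y_def h_def)
      then show ?thesis using 3 L bW B \<kappa> by (auto simp: K_def)
    qed
  qed
  then show ?thesis using level_le[OF y, where b=b, OF b(2)] unfolding K_def by linarith
qed

text \<open>The gap between the levels prevents the limit from resting in a well; hence the limit
  pays some potential near a time \<open>t0\<close>. A wrong end would then let late members of the
  sequence be cut so as to save that potential and fall below the level.\<close>

lemma heteroclinic_if_level_less:
  assumes b: "continuous_on UNIV b" "0 < c" "\<And>t. c \<le> b t" "\<And>t. b t \<le> B"
    and b': "continuous_on UNIV b'" "\<And>t. b t \<le> b' t" "((\<lambda>t. b' t - b t) \<longlongrightarrow> 0) at_infinity"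
    and less: "level b < level b'"
  shows "\<exists>x v. heteroclinic b x v"
proof -
  have b0: "0 \<le> b t" for t using b(2) b(3)[of t] by linarith
  have B: "B > 0" using b(2) b(3)[of 0] b(4)[of 0] by linarith
  obtain X G x v A where X: "\<And>n::nat. transition (X n) (G n)"
      "\<And>n. action b (X n) (G n) < level b + 1 / (real n + 1)" "\<And>n t. \<bar>X n t\<bar> \<le> A + \<bar>t\<bar>"
      "\<And>t. (\<lambda>n. X n t) \<longlonglongrightarrow> x t"
    and v: "\<And>t. (x has_real_derivative v t) (at t)" "\<And>t. (v has_real_derivative b t * w (x t)) (at t)"
    and ends: "(x \<longlongrightarrow> 1) at_top \<or> (x \<longlongrightarrow> -1) at_top" "(x \<longlongrightarrow> 1) at_bot \<or> (x \<longlongrightarrow> -1) at_bot"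
    by (rule minimizing_sequence[OF b(1-3)]) (rule that; assumption)
  have cx: "continuous_on UNIV x" using v(1) DERIV_isCont continuous_at_imp_continuous_on by blast
  have small: "\<forall>\<^sub>F n in sequentially. 1 / (real n + 1) < e" if "e > 0" for e
    using order_tendstoD(2)[OF LIMSEQ_inverse_real_of_nat that]
    by (simp add: inverse_eq_divide add.commute)
  define M where "M = level b + 1"
  have M: "M > 0" using level_nonneg[where b=b, OF b0] unfolding M_def by linarith
  \<comment> \<open>Otherwise the curves pay almost no potential on any fixed bounded interval, and
    outside a large one the two weights nearly agree. The actions for \<open>b\<close> and
    \<open>b'\<close> would then differ by less than the gap \<open>e\<close>.\<close>
  have "\<exists>t0. W (x t0) \<noteq> 0"
  proof (rule ccontr)
    assume "\<not> ?thesis"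
    then have Wx: "W (x t) = 0" for t by blast
    define e where "e = level b' - level b"
    have e: "e > 0" using less by (simp add: e_def)
    \<comment> \<open>With this value \<open>\<omega> / c * M\<close> is \<open>e / 3\<close>, one
      of three equal shares of the gap.\<close>
    define \<omega> where "\<omega> = e * c / (3 * M)"
    have \<omega>: "\<omega> > 0" using e b(2) M unfolding \<omega>_def by simp
    obtain R where R: "\<And>t. \<bar>t\<bar> \<ge> R \<Longrightarrow> b' t - b t < \<omega>"
      using order_tendstoD(2)[OF b'(3) \<omega>] unfolding eventually_at_infinity by auto
    have cd: "continuous_on UNIV (\<lambda>t. b' t - b t)" using b(1) b'(1) by (intro continuous_intros)
    have "(\<lambda>n. integral {-R..R} (\<lambda>t. (b' t - b t) * W (X n t))) \<longlonglongrightarrow> integral {-R..R} (\<lambda>t. (b' t - b t) * W (x t))"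
      by (rule potential_limit[OF cd X(1,3,4)])
    then have "(\<lambda>n. integral {-R..R} (\<lambda>t. (b' t - b t) * W (X n t))) \<longlonglongrightarrow> 0" by (simp add: Wx)
    then have "\<forall>\<^sub>F n in sequentially. integral {-R..R} (\<lambda>t. (b' t - b t) * W (X n t)) < e / 3"
      by (rule order_tendstoD(2)) (use e in simp)
    moreover have "\<forall>\<^sub>F n in sequentially. 1 / (real n + 1) < e / 3" by (rule small) (use e in simp)
    ultimately obtain n where n: "integral {-R..R} (\<lambda>t. (b' t - b t) * W (X n t)) < e / 3" "1 / (real n + 1) < e / 3"
      using eventually_happens'[OF sequentially_bot eventually_conj] by blast
    have pot: "(\<lambda>t. (b' t - b t) * W (X n t)) integrable_on {-R..R}"
      by (intro integrable_continuous_real potential_continuous cd curve_continuous[OF transition_curve[OF X(1)]])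
    let ?L = "lagrangian b (X n) (G n)"
    \<comment> \<open>The excess of \<open>b'\<close> over \<open>b\<close> is kept inside
      \<open>{-R..R}\<close>. Outside it is below \<omega>, and since \<open>c * W\<close> is at
      most the Lagrangian, \<open>\<omega> / c * ?L t\<close> covers it.\<close>
    have I: "((\<lambda>t. ?L t + (if t \<in> {-R..R} then (b' t - b t) * W (X n t) else 0) + \<omega> / c * ?L t) has_integral
       (action b (X n) (G n) + integral {-R..R} (\<lambda>t. (b' t - b t) * W (X n t)) + \<omega> / c * action b (X n) (G n))) UNIV"
      by (intro has_integral_add has_integral_mult_right action_UNIV X b
        has_integral_restrict_UNIV[THEN iffD2] integrable_integral[OF pot])
      have "action b' (X n) (G n) \<le> action b (X n) (G n) + integral {-R..R} (\<lambda>t. (b' t - b t) * W (X n t))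
      + \<omega> / c * action b (X n) (G n)"
    proof (rule has_integral_le[OF action_UNIV[OF X(1) b'(1)] I])
      fix t
      have Lt: "lagrangian b' (X n) (G n) t = ?L t + (b' t - b t) * W (X n t)"
        by (simp add: lagrangian_def algebra_simps)
      have nn: "0 \<le> \<omega> / c * ?L t" using \<omega> b(2) lagrangian_nonneg[of b, OF b0] by simp
      have "(b' t - b t) * W (X n t) \<le> \<omega> / c * ?L t" if "t \<notin> {-R..R}"
      proof -
        have "(b' t - b t) * W (X n t) \<le> \<omega> * W (X n t)"
        proof (rule mult_right_mono[OF _ W_nonneg])
          have "R \<le> \<bar>t\<bar>" using that by auto
          then show "b' t - b t \<le> \<omega>" using R[of t] by simp
        qed
        also have "\<dots> = \<omega> / c * (c * W (X n t))" using b(2) by simp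
        also have "\<dots> \<le> \<omega> / c * ?L t"
          using \<omega> b(2) mult_right_mono[OF b(3)[of t] W_nonneg[of "X n t"]]
          by (intro mult_left_mono) (auto simp: lagrangian_def intro: order_trans)
        finally show ?thesis .
      qed
      with nn show "lagrangian b' (X n) (G n) t \<le> ?L t + (if t \<in> {-R..R} then (b' t - b t) * W (X n t) else 0) + \<omega> / c * ?L t"
        unfolding Lt by auto
    qed
    moreover have "level b' \<le> action b' (X n) (G n)"
      by (rule level_le[OF X(1)]) (rule order_trans[OF b0 b'(2)])
    moreover have "\<omega> / c * action b (X n) (G n) \<le> e / 3"
    proof -
      have "1 / (real n + 1) \<le> 1" by simp
      then have "action b (X n) (G n) \<le> M" using X(2)[of n] unfolding M_def by linarith
      then have "\<omega> / c * action b (X n) (G n) \<le> \<omega> / c * M" using \<omega> b(2) by (intro mult_left_mono) auto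
      also have "\<dots> = e / 3" using M b(2) unfolding \<omega>_def by simp
      finally show ?thesis .
    qed
    moreover note n X(2)[of n]
    \<comment> \<open>The final bookkeeping, with actions and integrals replaced by plain real
      variables.\<close>
    moreover have False if "a' \<le> a + i + q" "level b' \<le> a'" "q \<le> e / 3" "i < e / 3" "r < e / 3" "a < level b + r"
      for a a' i q r :: real
      using that unfolding e_def by (simp add: field_simps)
    ultimately show False by blast
  qed
  then obtain t0 where t0: "W (x t0) \<noteq> 0" by blast
  \<comment> \<open>The potential that the limit pays just after \<open>t0\<close>. Late curves pay
    more than half of it there, and that is what a cut saves.\<close>
  define \<eta> where "\<eta> = integral {t0..t0+1} (\<lambda>t. b t * W (x t))"
  have "\<eta> \<ge> 0" unfolding \<eta>_def
    by (rule integral_nonneg) (use b0 W_nonneg potential_continuous[OF b(1) cx] in \<open>auto intro: integrable_continuous_real\<close>)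
  moreover have "\<eta> \<noteq> 0"
    unfolding \<eta>_def
    by (subst integral_eq_0_iff) (use potential_continuous[OF b(1) cx] b0 W_nonneg t0 b(2) b(3)[of t0] in \<open>auto intro!: bexI[of _ t0]\<close>)
  ultimately have \<eta>: "\<eta> > 0" by simp
  \<comment> \<open>The price \<open>d\<^sup>2 / 2 + B * e\<close> of a cut is to be at most
    \<open>\<eta> / 4\<close>; each summand receives \<open>\<eta> / 8\<close>.\<close>
  define e where "e = \<eta> / (8 * B)"
  have e: "e > 0" using \<eta> B unfolding e_def by simp
  have near: "\<exists>d>0. d\<^sup>2 / 2 \<le> \<eta> / 8 \<and> (\<forall>y. \<bar>y - z\<bar> \<le> d \<longrightarrow> W y \<le> e)" if z: "W z = 0" for z
  proof -
    have "isCont W z" using W_deriv DERIV_isCont by blast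
    then obtain r where r: "r > 0" "\<And>y. \<bar>y - z\<bar> < r \<Longrightarrow> \<bar>W y - W z\<bar> < e"
      using e unfolding continuous_at_eps_delta dist_real_def by blast
    define d where "d = min (r / 2) (min 1 (\<eta> / 4))"
    have d: "d > 0" "d \<le> 1" "d \<le> \<eta> / 4" "d < r" using r(1) \<eta> unfolding d_def by auto
    have "d\<^sup>2 \<le> d" using d by (simp add: power2_eq_square mult_left_le)
    then have "d\<^sup>2 / 2 \<le> \<eta> / 8" using d by simp
    moreover have "W y \<le> e" if "\<bar>y - z\<bar> \<le> d" for y using r(2)[of y] that d z by auto
    ultimately show ?thesis using d(1) by blast
  qed
  have gain: "\<forall>\<^sub>F n in sequentially. \<eta> / 2 < integral {t0..t0+1} (\<lambda>t. b t * W (X n t))"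
    by (rule order_tendstoD(1)[OF potential_limit[OF b(1) X(1,3,4)]]) (use \<eta> in \<open>simp add: \<eta>_def[symmetric]\<close>)
  have tiny: "\<forall>\<^sub>F n in sequentially. 1 / (real n + 1) < \<eta> / 4" by (rule small) (use \<eta> in simp)
  have cost: "d\<^sup>2 / 2 + B * e \<le> \<eta> / 4" if "d\<^sup>2 / 2 \<le> \<eta> / 8" for d
    using that B unfolding e_def by simp
  \<comment> \<open>If the limit starts at 1, some late curve is within \<open>d\<close> of 1 at a
    time \<open>s \<le> t0\<close>. Cutting there saves more than \<open>\<eta> / 2\<close> and
    costs at most \<open>\<eta> / 4\<close>, while the curve exceeds the level by less than
    \<open>\<eta> / 4\<close>.\<close>
  have "\<not> (x \<longlongrightarrow> 1) at_bot"
  proof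
    assume lim: "(x \<longlongrightarrow> 1) at_bot"
    obtain d where d: "d > 0" "d\<^sup>2 / 2 \<le> \<eta> / 8" "\<And>y. \<bar>y - 1\<bar> \<le> d \<Longrightarrow> W y \<le> e"
      using near[of 1] W_zero by auto
    have "\<forall>\<^sub>F t in at_bot. dist (x t) 1 < d \<and> t \<le> t0"
      using tendstoD[OF lim d(1)] eventually_le_at_bot[of t0] by (rule eventually_conj)
    then obtain s where s: "dist (x s) 1 < d" "s \<le> t0"
      using eventually_happens'[OF trivial_limit_at_bot_linorder] by blast
    have "((\<lambda>n. dist (X n s) 1) \<longlongrightarrow> dist (x s) 1) sequentially" by (intro tendsto_intros X)
    then have "\<forall>\<^sub>F n in sequentially. dist (X n s) 1 < d" using s(1) by (rule order_tendstoD(2))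
    then obtain n where n: "dist (X n s) 1 < d" "\<eta> / 2 < integral {t0..t0+1} (\<lambda>t. b t * W (X n t))"
      "1 / (real n + 1) < \<eta> / 4"
      using eventually_happens'[OF sequentially_bot eventually_conj[OF _ eventually_conj[OF gain tiny]]] by blast
    have "level b \<le> action b (X n) (G n) - integral {t0..t0+1} (\<lambda>t. b t * W (X n t)) + (d\<^sup>2 / 2 + B * e)"
      by (rule cut_right_tail[OF X(1) b(1) b0 b(4) _ d(3) s(2)]) (use n(1) in \<open>auto simp: dist_real_def\<close>)
    then show False using n(2,3) cost[OF d(2)] X(2)[of n] by linarith
  qed
  moreover have "\<not> (x \<longlongrightarrow> -1) at_top"
  proof
    assume lim: "(x \<longlongrightarrow> -1) at_top"
    obtain d where d: "d > 0" "d\<^sup>2 / 2 \<le> \<eta> / 8" "\<And>y. \<bar>y + 1\<bar> \<le> d \<Longrightarrow> W y \<le> e"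
      using near[of "-1"] W_zero by auto
    have "\<forall>\<^sub>F t in at_top. dist (x t) (-1) < d \<and> t0 + 1 \<le> t"
      using tendstoD[OF lim d(1)] eventually_ge_at_top[of "t0 + 1"] by (rule eventually_conj)
    then obtain s where s: "dist (x s) (-1) < d" "t0 + 1 \<le> s"
      using eventually_happens'[OF trivial_limit_at_top_linorder] by blast
    have "((\<lambda>n. dist (X n s) (-1)) \<longlongrightarrow> dist (x s) (-1)) sequentially" by (intro tendsto_intros X)
    then have "\<forall>\<^sub>F n in sequentially. dist (X n s) (-1) < d" using s(1) by (rule order_tendstoD(2))
    then obtain n where n: "dist (X n s) (-1) < d" "\<eta> / 2 < integral {t0..t0+1} (\<lambda>t. b t * W (X n t))"
      "1 / (real n + 1) < \<eta> / 4"
      using eventually_happens'[OF sequentially_bot eventually_conj[OF _ eventually_conj[OF gain tiny]]] by blast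
    have "level b \<le> action b (X n) (G n) - integral {t0..t0+1} (\<lambda>t. b t * W (X n t)) + (d\<^sup>2 / 2 + B * e)"
      by (rule cut_left_tail[OF X(1) b(1) b0 b(4) _ d(3) s(2)]) (use n(1) in \<open>auto simp: dist_real_def\<close>)
    then show False using n(2,3) cost[OF d(2)] X(2)[of n] by linarith
  qed
  ultimately show ?thesis using ends v unfolding heteroclinic_def by blast
qed

text \<open>By Hoelder continuity, the length of the interval on which a curve of bounded action stays in the
  middle region around a zero is bounded below.\<close>

lemma potential_near_zero:
  assumes b: "continuous_on UNIV b" "\<And>t. 0 \<le> b t" and M: "0 < M"
  obtains \<rho> \<mu> where "0 < \<rho>" "0 < \<mu>"
    "\<And>x g \<tau> t. transition x g \<Longrightarrow> action b x g \<le> M \<Longrightarrow> x \<tau> = 0 \<Longrightarrow> \<bar>t - \<tau>\<bar> \<le> \<rho> \<Longrightarrow> \<mu> \<le> W (x t)"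
proof -
  obtain \<mu> where \<mu>: "\<mu> > 0" "\<And>y. 1/2 \<le> \<bar>y - 1\<bar> \<Longrightarrow> 1/2 \<le> \<bar>y + 1\<bar> \<Longrightarrow> \<mu> \<le> W y"
    using W_away[of "1/2"] by auto
  define \<rho> where "\<rho> = 1 / (8 * M)"
  have "\<mu> \<le> W (x t)" if x: "transition x g" "action b x g \<le> M" "x \<tau> = 0" "\<bar>t - \<tau>\<bar> \<le> \<rho>" for x g \<tau> t
  proof -
    have "(x t - x \<tau>)\<^sup>2 \<le> 2 * M * \<bar>t - \<tau>\<bar>" by (rule action_hoelder[OF x(1) b x(2)])
    also have "\<dots> \<le> 2 * M * \<rho>" using x(4) M by (intro mult_left_mono) auto
    also have "\<dots> = (1/2)\<^sup>2" using M by (simp add: \<rho>_def power2_eq_square)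
    finally have "\<bar>x t\<bar> \<le> 1/2" using abs_le_square_iff[of "x t" "1/2"] x(3) by simp
    then show ?thesis by (intro \<mu>(2)) linarith+
  qed
  moreover have "\<rho> > 0" using M by (simp add: \<rho>_def)
  ultimately show ?thesis using \<mu>(1) that by blast
qed

text \<open>Around a zero far out the curve pays a potential of at least \<mu> for a time \<rho>
  under a huge weight. So all curves of the sequence are negative to the left and positive to the
  right of one common interval; the limit inherits the weak inequalities, which decide its
  ends.\<close>

lemma heteroclinic_if_coercive:
  assumes b: "continuous_on UNIV b" "0 < c" "\<And>t. c \<le> b t" and inf: "filterlim b at_top at_infinity"
  shows "\<exists>x v. heteroclinic b x v"
proof -
  have b0: "0 \<le> b t" for t using b(2) b(3)[of t] by linarith
  obtain X G x v A where X: "\<And>n::nat. transition (X n) (G n)"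
      "\<And>n. action b (X n) (G n) < level b + 1 / (real n + 1)" "\<And>n t. \<bar>X n t\<bar> \<le> A + \<bar>t\<bar>"
      "\<And>t. (\<lambda>n. X n t) \<longlonglongrightarrow> x t"
    and v: "\<And>t. (x has_real_derivative v t) (at t)" "\<And>t. (v has_real_derivative b t * w (x t)) (at t)"
    and ends: "(x \<longlongrightarrow> 1) at_top \<or> (x \<longlongrightarrow> -1) at_top" "(x \<longlongrightarrow> 1) at_bot \<or> (x \<longlongrightarrow> -1) at_bot"
    by (rule minimizing_sequence[OF b]) (rule that; assumption)
  define M where "M = level b + 1"
  have M: "M > 0" using level_nonneg[where b=b, OF b0] unfolding M_def by linarith
  have XM: "action b (X n) (G n) \<le> M" for n
  proof -
    have "1 / (real n + 1) \<le> 1" by simp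
    then show ?thesis using X(2)[of n] unfolding M_def by linarith
  qed
  have cX: "continuous_on S (X n)" for n S by (rule curve_continuous[OF transition_curve[OF X(1)]])
  obtain \<rho> \<mu> where \<rho>: "0 < \<rho>" "0 < \<mu>"
    "\<And>x g \<tau> t. transition x g \<Longrightarrow> action b x g \<le> M \<Longrightarrow> x \<tau> = 0 \<Longrightarrow> \<bar>t - \<tau>\<bar> \<le> \<rho> \<Longrightarrow> \<mu> \<le> W (x t)"
    by (rule potential_near_zero[OF b(1) b0 M]) (rule that; assumption)
  \<comment> \<open>Under a weight of at least \<open>K\<close>, the passage through a zero costs
    \<open>K * \<mu> * \<rho> = M + 1\<close>.\<close>
  define K where "K = (M + 1) / (\<rho> * \<mu>)"
  have "\<forall>\<^sub>F t in at_infinity. K \<le> b t" using inf by (simp add: filterlim_at_top)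
  then obtain R0 where R0: "\<And>t. R0 \<le> \<bar>t\<bar> \<Longrightarrow> K \<le> b t" unfolding eventually_at_infinity by auto
  define R where "R = \<bar>R0\<bar>"
  \<comment> \<open>The interval starting at \<open>s\<close> is used with \<tau> as its right end
    on the left side and as its left end on the right side, so that it points away from the
    origin.\<close>
  have far: False if "X n \<tau> = 0" "\<bar>\<tau> - s\<bar> \<le> \<rho>" "\<bar>s + \<rho> - \<tau>\<bar> \<le> \<rho>" "\<And>t. t \<in> {s..s+\<rho>} \<Longrightarrow> R \<le> \<bar>t\<bar>" for n \<tau> s
  proof -
    have "integral {s..s+\<rho>} (\<lambda>_. K * \<mu>) \<le> integral {s..s+\<rho>} (\<lambda>t. b t * W (X n t))"
    proof (rule integral_le)
      fix t assume t: "t \<in> {s..s+\<rho>}"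
      then have "\<mu> \<le> W (X n t)" using that(2,3) by (intro \<rho>(3)[OF X(1) XM that(1)]) auto
      moreover have "K \<le> b t" using R0[of t] that(4)[OF t] unfolding R_def by linarith
      ultimately show "K * \<mu> \<le> b t * W (X n t)" using b0 \<rho>(2) by (intro mult_mono) auto
    qed (auto intro: integrable_continuous_real potential_continuous b cX)
    then have "M + 1 \<le> integral {s..s+\<rho>} (\<lambda>t. b t * W (X n t))" using \<rho>(1,2) by (simp add: K_def)
    also have "\<dots> \<le> M" by (rule order_trans[OF integral_potential_le_action[OF X(1) b(1) b0] XM])
    finally show False by simp
  qed
  have left: "X n t < 0" if t: "t \<le> -R" for n t
  proof (rule ccontr)
    assume nn: "\<not> X n t < 0"
    obtain S where S: "S > \<bar>t\<bar>" "\<And>t. t \<le> -S \<Longrightarrow> X n t = -1" using transitionE[OF X(1)] by metis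
    obtain \<tau> where "-S \<le> \<tau>" "\<tau> \<le> t" "X n \<tau> = 0"
      using IVT'[of "X n" "-S" 0 t] nn S(1) S(2)[of "-S"] cX by force
    moreover have "R \<le> \<bar>r\<bar>" if "r \<in> {\<tau> - \<rho>..\<tau> - \<rho> + \<rho>}" for r using that \<open>\<tau> \<le> t\<close> t by auto
    ultimately show False using far[of n \<tau> "\<tau> - \<rho>"] \<rho>(1) by auto
  qed
  have right: "X n t > 0" if t: "t \<ge> R" for n t
  proof (rule ccontr)
    assume nn: "\<not> X n t > 0"
    obtain S where S: "S > \<bar>t\<bar>" "\<And>t. t \<ge> S \<Longrightarrow> X n t = 1" using transitionE[OF X(1)] by metis
    obtain \<tau> where "t \<le> \<tau>" "\<tau> \<le> S" "X n \<tau> = 0"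
      using IVT'[of "X n" t 0 S] nn S(1) S(2)[of S] cX by force
    moreover have "R \<le> \<bar>r\<bar>" if "r \<in> {\<tau>..\<tau> + \<rho>}" for r using that \<open>t \<le> \<tau>\<close> t by auto
    ultimately show False using far[of n \<tau> \<tau>] \<rho>(1) by auto
  qed
  have "x t \<le> 0" if "t \<le> -R" for t
    by (rule LIMSEQ_le_const2[OF X(4)]) (use left[OF that] less_imp_le in blast)
  then have "\<forall>\<^sub>F t in at_bot. x t \<le> 0" by (rule eventually_mono[OF eventually_le_at_bot[of "-R"]])
  then have "\<not> (x \<longlongrightarrow> 1) at_bot" using tendsto_upperbound[of x 1 at_bot 0] by auto
  moreover have "x t \<ge> 0" if "t \<ge> R" for t
    by (rule LIMSEQ_le_const[OF X(4)]) (use right[OF that] less_imp_le in blast)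
  then have "\<forall>\<^sub>F t in at_top. x t \<ge> 0" by (rule eventually_mono[OF eventually_ge_at_top[of R]])
  then have "\<not> (x \<longlongrightarrow> -1) at_top" using tendsto_lowerbound[of x "-1" at_top 0] by auto
  ultimately show ?thesis using ends v unfolding heteroclinic_def by blast
qed

lemma action_shift:
  assumes x: "transition x g" and b: "continuous_on UNIV b" "\<And>t. b (t + k) = b t"
  shows "action b (\<lambda>t. x (t + k)) (\<lambda>t. g (t + k)) = action b x g"
proof -
  let ?L = "lagrangian b x g"
  have L: "lagrangian b (\<lambda>t. x (t + k)) (\<lambda>t. g (t + k)) = (\<lambda>t. ?L (t + k))"
    by (rule ext) (simp add: lagrangian_def b(2))
  obtain S where S: "\<And>b t. t \<le> -S \<or> t \<ge> S \<Longrightarrow> lagrangian b x g t = 0"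
    using transition_lagrangianE[OF x] by metis
  have "(?L has_integral action b x g) {(-S - k) + k..(S - k) + k}"
    by (rule action_has_integral[OF x b(1)]) (use S in auto)
  then have "((\<lambda>t. ?L (t + k)) has_integral action b x g) {-S - k..S - k}"
    by (rule has_integral_shift_real)
  then have "((\<lambda>t. ?L (t + k)) has_integral action b x g) UNIV"
    by (rule has_integral_on_superset) (use S in auto)
  then show ?thesis unfolding action_def L by (simp add: integral_unique)
qed

text \<open>For a nearly minimal curve of the larger weight with a zero in \<open>{0..T}\<close>,
  passing to \<open>b\<close> saves at least \<eta>, because around the zero both \<open>W\<close>
  and \<open>b' - b\<close> are bounded below. Only \<open>b'\<close> has to be periodic, as the
  translation is made before \<open>b\<close> enters.\<close>

lemma level_less_periodic:
  assumes b: "continuous_on UNIV b" "0 < c" "\<And>t. c \<le> b t"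
    and b': "continuous_on UNIV b'" "\<And>t. b t < b' t" "0 < T" "\<And>t. b' (t + T) = b' t"
  shows "level b < level b'"
proof -
  have b0: "0 \<le> b t" for t using b(2) b(3)[of t] by linarith
  have b'0: "0 \<le> b' t" for t using b0[of t] b'(2)[of t] by linarith
  define M where "M = level b' + 1"
  have M: "M > 0" using level_nonneg[where b=b', OF b'0] unfolding M_def by linarith
  interpret periodic_fun_simple b' T by unfold_locales (rule b'(4))
  obtain \<rho> \<mu> where \<rho>: "0 < \<rho>" "0 < \<mu>"
    "\<And>x g \<tau> t. transition x g \<Longrightarrow> action b' x g \<le> M \<Longrightarrow> x \<tau> = 0 \<Longrightarrow> \<bar>t - \<tau>\<bar> \<le> \<rho> \<Longrightarrow> \<mu> \<le> W (x t)"
    by (rule potential_near_zero[OF b'(1) b'0 M]) (rule that; assumption)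
  have cd: "continuous_on S (\<lambda>t. b' t - b t)" for S
    by (intro continuous_intros continuous_on_subset[OF b(1)] continuous_on_subset[OF b'(1)]) auto
  \<comment> \<open>The interval \<open>{\<tau>..\<tau>+\<rho>}\<close> used below starts in
    \<open>{0..T}\<close>, so \<open>{0..T+\<rho>}\<close> contains it.\<close>
  obtain s0 where s0: "\<And>t. t \<in> {0..T+\<rho>} \<Longrightarrow> b' s0 - b s0 \<le> b' t - b t"
    using continuous_attains_inf[OF compact_Icc _ cd, of 0 "T + \<rho>"] b'(3) \<rho>(1) by force
  define \<kappa> where "\<kappa> = b' s0 - b s0"
  have \<kappa>: "\<kappa> > 0" using b'(2)[of s0] by (simp add: \<kappa>_def)
  define \<eta> where "\<eta> = \<kappa> * \<mu> * \<rho>"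
  have \<eta>: "\<eta> > 0" using \<kappa> \<rho> by (simp add: \<eta>_def)
  \<comment> \<open>The 1 keeps the action below \<open>M\<close>, as the choice of \<rho> demands;
    \<open>\<eta> / 2\<close> keeps the excess below the saving \<eta>.\<close>
  obtain x g where x: "transition x g" "action b' x g < level b' + min 1 (\<eta> / 2)"
    using level_approx[of "min 1 (\<eta> / 2)" b'] \<eta> by auto
  obtain \<tau>0 where \<tau>0: "x \<tau>0 = 0" using transition_zero[OF x(1)] by blast
  define k where "k = of_int \<lfloor>\<tau>0 / T\<rfloor> * T"
  define \<tau> where "\<tau> = \<tau>0 - k"
  have \<tau>: "\<tau> \<in> {0..T}"
  proof -
    have "real_of_int \<lfloor>\<tau>0 / T\<rfloor> * T \<le> \<tau>0"
      using of_int_floor_le[of "\<tau>0 / T"] unfolding pos_le_divide_eq[OF b'(3)] .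
    moreover have "\<tau>0 / T < real_of_int \<lfloor>\<tau>0 / T\<rfloor> + 1" by linarith
    then have "\<tau>0 < real_of_int \<lfloor>\<tau>0 / T\<rfloor> * T + T"
      unfolding pos_divide_less_eq[OF b'(3)] by (simp add: algebra_simps)
    ultimately show ?thesis unfolding \<tau>_def k_def by simp
  qed
  let ?z = "\<lambda>t. x (t + k)" and ?h = "\<lambda>t. g (t + k)"
  have z: "transition ?z ?h" by (rule transition_shift[OF x(1)])
  have az: "action b' ?z ?h = action b' x g"
    by (rule action_shift[OF x(1) b'(1)]) (simp add: k_def plus_of_int)
  have pot: "(\<lambda>t. (b' t - b t) * W (?z t)) integrable_on {\<tau>..\<tau>+\<rho>}"
    by (intro integrable_continuous_real potential_continuous cd curve_continuous[OF transition_curve[OF z]])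
  have I: "((\<lambda>t. lagrangian b' ?z ?h t - (if t \<in> {\<tau>..\<tau>+\<rho>} then (b' t - b t) * W (?z t) else 0)) has_integral
      (action b' ?z ?h - integral {\<tau>..\<tau>+\<rho>} (\<lambda>t. (b' t - b t) * W (?z t)))) UNIV"
    by (intro has_integral_diff action_UNIV z b' has_integral_restrict_UNIV[THEN iffD2] integrable_integral[OF pot])
  have "action b ?z ?h \<le> action b' ?z ?h - integral {\<tau>..\<tau>+\<rho>} (\<lambda>t. (b' t - b t) * W (?z t))"
  proof (rule has_integral_le[OF action_UNIV[OF z b(1)] I])
    fix t
    have "lagrangian b' ?z ?h t = lagrangian b ?z ?h t + (b' t - b t) * W (?z t)"
      by (simp add: lagrangian_def algebra_simps)
    moreover have "0 \<le> (b' t - b t) * W (?z t)" using b'(2)[of t] W_nonneg[of "?z t"] by simp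
    ultimately show "lagrangian b ?z ?h t
        \<le> lagrangian b' ?z ?h t - (if t \<in> {\<tau>..\<tau>+\<rho>} then (b' t - b t) * W (?z t) else 0)" by simp
  qed
  moreover have "\<eta> \<le> integral {\<tau>..\<tau>+\<rho>} (\<lambda>t. (b' t - b t) * W (?z t))"
  proof -
    have "integral {\<tau>..\<tau>+\<rho>} (\<lambda>_. \<kappa> * \<mu>) \<le> integral {\<tau>..\<tau>+\<rho>} (\<lambda>t. (b' t - b t) * W (?z t))"
    proof (rule integral_le[OF _ pot])
      fix t assume t: "t \<in> {\<tau>..\<tau>+\<rho>}"
      have "\<mu> \<le> W (?z t)"
        by (rule \<rho>(3)[OF z, of \<tau>]) (use az x(2) t \<tau>0 in \<open>auto simp: M_def \<tau>_def\<close>)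
      moreover have "\<kappa> \<le> b' t - b t" unfolding \<kappa>_def by (rule s0) (use t \<tau> in auto)
      ultimately show "\<kappa> * \<mu> \<le> (b' t - b t) * W (?z t)" using \<kappa> \<rho>(2) by (intro mult_mono) auto
    qed auto
    then show ?thesis using \<rho>(1) by (simp add: \<eta>_def mult_ac)
  qed
  ultimately show ?thesis using level_le[OF z, where b=b, OF b0] az x(2) \<eta> by linarith
qed

end

section \<open>Confinement of solutions to the open interval\<close>

lemma continuous_bounded_Icc:
  fixes f :: "real \<Rightarrow> real"
  assumes "continuous_on {s..t} f"
  obtains B where "0 \<le> B" "\<And>u. u \<in> {s..t} \<Longrightarrow> \<bar>f u\<bar> \<le> B"
proof -
  have "bounded (f ` {s..t})" using assms by (simp add: compact_imp_bounded compact_continuous_image)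
  then obtain B where "\<forall>z\<in>f ` {s..t}. \<bar>z\<bar> \<le> B" unfolding bounded_real by blast
  then show ?thesis by (intro that[of "max 0 B"]) (auto simp: le_max_iff_disj)
qed

lemma DERIV_glue:
  fixes f g :: "real \<Rightarrow> real"
  assumes f: "\<And>y. (f has_real_derivative f' y) (at y)" and g: "\<And>y. (g has_real_derivative g' y) (at y)"
    and eq: "f p = g p" "f' p = g' p"
  shows "((\<lambda>y. if y \<le> p then f y else g y) has_real_derivative (if y \<le> p then f' y else g' y)) (at y)"
proof -
  consider "y < p" | "y = p" | "p < y" by linarith
  then show ?thesis
  proof cases
    case 1
    have "\<forall>\<^sub>F z in nhds y. z \<in> {..<p}" by (rule eventually_nhds_in_open) (use 1 in auto)
    then have "\<forall>\<^sub>F z in nhds y. (if z \<le> p then f z else g z) = f z" by (rule eventually_mono) auto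
    from DERIV_cong_ev[OF refl this, of "f' y" "f' y"] f[of y] 1 show ?thesis by simp
  next
    case 3
    have "\<forall>\<^sub>F z in nhds y. z \<in> {p<..}" by (rule eventually_nhds_in_open) (use 3 in auto)
    then have "\<forall>\<^sub>F z in nhds y. (if z \<le> p then f z else g z) = g z" by (rule eventually_mono) auto
    from DERIV_cong_ev[OF refl this, of "g' y" "g' y"] g[of y] 3 show ?thesis by simp
  next
    case 2
    let ?h = "\<lambda>y. if y \<le> p then f y else g y"
    have "((\<lambda>y. (?h y - ?h p) / (y - p)) \<longlongrightarrow> f' p) (at_left p)"
    proof (rule Lim_transform_eventually)
      show "((\<lambda>y. (f y - f p) / (y - p)) \<longlongrightarrow> f' p) (at_left p)"
        using has_field_derivative_at_within[OF f[of p]] by (simp add: has_field_derivative_iff)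
      show "\<forall>\<^sub>F y in at_left p. (f y - f p) / (y - p) = (?h y - ?h p) / (y - p)"
        by (auto simp: eventually_at_filter)
    qed
    moreover have "((\<lambda>y. (?h y - ?h p) / (y - p)) \<longlongrightarrow> f' p) (at_right p)"
    proof (rule Lim_transform_eventually)
      show "((\<lambda>y. (g y - g p) / (y - p)) \<longlongrightarrow> f' p) (at_right p)"
        using has_field_derivative_at_within[OF g[of p]] eq(2) by (simp add: has_field_derivative_iff)
      show "\<forall>\<^sub>F y in at_right p. (g y - g p) / (y - p) = (?h y - ?h p) / (y - p)"
        using eq(1) by (auto simp: eventually_at_filter)
    qed
    ultimately show ?thesis using 2 by (simp add: has_field_derivative_iff filterlim_at_split)
  qed
qed

text \<open>A maximum principle: as both limits are at most \<open>K\<close>, a value above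
  \<open>K\<close> would lead to a global maximum above \<open>K\<close>. There \<open>v\<close>
  vanishes and has positive derivative, so \<open>x\<close> would increase to the right of its
  maximum.\<close>

lemma convex_above_level_imp_le:
  fixes x :: "real \<Rightarrow> real"
  assumes x: "\<And>t. (x has_real_derivative v t) (at t)" "\<And>t. (v has_real_derivative q t) (at t)"
    and q: "\<And>t. x t > K \<Longrightarrow> q t > 0"
    and lim: "(x \<longlongrightarrow> l) at_bot" "(x \<longlongrightarrow> m) at_top" "l \<le> K" "m \<le> K"
  shows "x t \<le> K"
proof (rule ccontr)
  assume "\<not> x t \<le> K"
  then have t: "x t > K" by simp
  have cx: "continuous_on A x" for A using x(1) DERIV_isCont continuous_at_imp_continuous_on by blast
  have "\<forall>\<^sub>F s in at_bot. x s < x t" by (rule order_tendstoD(2)[OF lim(1)]) (use t lim in simp)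
  then obtain P where P: "\<And>s. s \<le> P \<Longrightarrow> x s < x t" unfolding eventually_at_bot_linorder by blast
  have "\<forall>\<^sub>F s in at_top. x s < x t" by (rule order_tendstoD(2)[OF lim(2)]) (use t lim in simp)
  then obtain Q where Q: "\<And>s. s \<ge> Q \<Longrightarrow> x s < x t" unfolding eventually_at_top_linorder by blast
  have "t \<in> {P..Q}" using P[of t] Q[of t] by force
  then obtain t0 where t0: "t0 \<in> {P..Q}" "\<And>s. s \<in> {P..Q} \<Longrightarrow> x s \<le> x t0"
    using continuous_attains_sup[of "{P..Q}" x] cx by auto
  have mx: "x s \<le> x t0" for s
    using t0(2)[of s] t0(2)[OF \<open>t \<in> {P..Q}\<close>] P[of s] Q[of s] by (cases "s \<in> {P..Q}") auto
  have v0: "v t0 = 0" by (rule DERIV_local_max[OF x(1) zero_less_one]) (use mx in auto)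
  have "q t0 > 0" using q[of t0] mx[of t] t by simp
  from DERIV_pos_inc_right[OF x(2)[of t0] this] obtain d where d: "d > 0"
    "\<And>h. h > 0 \<Longrightarrow> h < d \<Longrightarrow> v (t0 + h) > 0" using v0 by auto
  have "x t0 < x (t0 + d / 2)"
  proof (rule DERIV_pos_imp_increasing_open[of t0 "t0 + d / 2" x])
    fix s assume s: "t0 < s" "s < t0 + d / 2"
    show "\<exists>y. (x has_real_derivative y) (at s) \<and> 0 < y"
      using x(1)[of s] d(2)[of "s - t0"] s d(1) by auto
  qed (use d cx in auto)
  then show False using mx[of "t0 + d / 2"] by simp
qed

text \<open>A Gronwall argument: the derivative of the sum of the squares of \<open>u\<close> and
  \<open>v\<close> is at most \<open>1 + M\<close> times that sum, so \<open>E\<close> is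
  nonincreasing and stays at its initial value 0.\<close>

lemma linear_bound_ode_zero_forward:
  fixes u :: "real \<Rightarrow> real"
  assumes u: "\<And>t. (u has_real_derivative v t) (at t)" "\<And>t. (v has_real_derivative q t) (at t)"
    and q: "\<And>t. t \<in> {s..r} \<Longrightarrow> \<bar>q t\<bar> \<le> M * \<bar>u t\<bar>"
    and M: "0 \<le> M" and s: "u s = 0" "v s = 0" "s \<le> r"
  shows "u r = 0"
proof -
  define E where "E t = ((u t)\<^sup>2 + (v t)\<^sup>2) * exp (- (1 + M) * t)" for t
  have "E r \<le> E s"
  proof (rule DERIV_nonpos_imp_nonincreasing[OF s(3)])
    fix t assume t: "s \<le> t" "t \<le> r"
    let ?D = "(2 * u t * v t + 2 * v t * q t - (1 + M) * ((u t)\<^sup>2 + (v t)\<^sup>2)) * exp (- (1 + M) * t)"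
    have "(E has_real_derivative ?D) (at t)"
      unfolding E_def[abs_def]
      by (auto intro!: derivative_eq_intros u simp: algebra_simps)
    moreover have "?D \<le> 0"
    proof -
      have Q: "\<bar>q t\<bar> \<le> M * \<bar>u t\<bar>" using q t by simp
      have "2 * v t * q t \<le> 2 * \<bar>v t\<bar> * \<bar>q t\<bar>" by (metis abs_ge_self abs_mult abs_numeral)
      also have "\<dots> \<le> 2 * \<bar>v t\<bar> * (M * \<bar>u t\<bar>)" by (intro mult_left_mono Q) auto
      finally have 1: "2 * v t * q t \<le> M * (2 * \<bar>u t\<bar> * \<bar>v t\<bar>)" by (simp add: mult_ac)
      have "2 * \<bar>u t\<bar> * \<bar>v t\<bar> \<le> (u t)\<^sup>2 + (v t)\<^sup>2"
        using sum_squares_bound[of "\<bar>u t\<bar>" "\<bar>v t\<bar>"] by simp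
      then have 2: "M * (2 * \<bar>u t\<bar> * \<bar>v t\<bar>) \<le> M * ((u t)\<^sup>2 + (v t)\<^sup>2)"
        using M by (rule mult_left_mono)
      have 3: "2 * u t * v t \<le> (u t)\<^sup>2 + (v t)\<^sup>2" by (rule sum_squares_bound)
      have "2 * u t * v t + 2 * v t * q t - (1 + M) * ((u t)\<^sup>2 + (v t)\<^sup>2) \<le> 0"
        using 1 2 3 unfolding distrib_right mult_1 by linarith
      then show ?thesis by (simp add: mult_nonpos_nonneg)
    qed
    ultimately show "\<exists>y. (E has_real_derivative y) (at t) \<and> y \<le> 0" by blast
  qed
  then have "((u r)\<^sup>2 + (v r)\<^sup>2) * exp (- (1 + M) * r) \<le> 0" using s by (simp add: E_def)
  then have "(u r)\<^sup>2 + (v r)\<^sup>2 \<le> 0" by (simp add: mult_le_0_iff)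
  then show ?thesis by (simp add: sum_power2_le_zero_iff)
qed

text \<open>The constant may depend on the time window because a coercive weight is unbounded. Times
  before \<open>s\<close> are reached by reversing time.\<close>

lemma linear_bound_ode_zero:
  fixes u :: "real \<Rightarrow> real"
  assumes u: "\<And>t. (u has_real_derivative v t) (at t)" "\<And>t. (v has_real_derivative q t) (at t)"
    and q: "\<And>R. \<exists>M\<ge>0. \<forall>t. \<bar>t\<bar> \<le> R \<longrightarrow> \<bar>q t\<bar> \<le> M * \<bar>u t\<bar>"
    and s: "u s = 0" "v s = 0"
  shows "u r = 0"
proof -
  obtain M where M: "M \<ge> 0" "\<And>t. \<bar>t\<bar> \<le> \<bar>s\<bar> + \<bar>r\<bar> \<Longrightarrow> \<bar>q t\<bar> \<le> M * \<bar>u t\<bar>" using q by blast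
  show ?thesis
  proof (cases "s \<le> r")
    case True
    show ?thesis
      by (rule linear_bound_ode_zero_forward[OF u _ M(1) s True]) (use M(2) in auto)
  next
    case False
    have "u (- (- r)) = 0"
    proof (rule linear_bound_ode_zero_forward[of "\<lambda>t. u (- t)" "\<lambda>t. - v (- t)" "\<lambda>t. q (- t)" "- s" "- r" M])
      show "((\<lambda>t. u (- t)) has_real_derivative - v (- t)) (at t)" for t
        using DERIV_chain2[OF u(1) DERIV_minus[OF DERIV_ident], of t] by simp
      show "((\<lambda>t. - v (- t)) has_real_derivative q (- t)) (at t)" for t
        using DERIV_minus[OF DERIV_chain2[OF u(2) DERIV_minus[OF DERIV_ident], of t]] by simp
    qed (use s False M in auto)
    then show ?thesis by simp
  qed
qed

section \<open>Passing from \<open>V\<close> to a double well and back\<close>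

text \<open>Outside \<open>[-1, 1]\<close> the potential is replaced by a quadratic, so that its zeros are exactly the two wells
  and the maximum principle confines solutions to \<open>[-1, 1]\<close>.\<close>

definition confined :: "(real \<Rightarrow> real) \<Rightarrow> real \<Rightarrow> real" where
  "confined V y = (if y \<le> 1 then if y \<le> -1 then (y + 1)\<^sup>2 else V y else (y - 1)\<^sup>2)"

definition confined_deriv :: "(real \<Rightarrow> real) \<Rightarrow> real \<Rightarrow> real" where
  "confined_deriv V y = (if y \<le> 1 then if y \<le> -1 then 2 * (y + 1) else deriv V y else 2 * (y - 1))"

lemma C2_DERIV:
  assumes "C2 f"
  shows "(f has_real_derivative deriv f y) (at y)" "(deriv f has_real_derivative deriv (deriv f) y) (at y)"
  using assms by (auto simp: C2_def DERIV_deriv_iff_real_differentiable)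

context
  fixes V :: "real \<Rightarrow> real"
  assumes C2: "C2 V" and nonneg: "\<And>y. V y \<ge> 0" and wells: "V (-1) = 0" "V 1 = 0"
    and pos: "\<And>y. -1 < y \<Longrightarrow> y < 1 \<Longrightarrow> V y > 0"
begin

lemma deriv_wells: "deriv V (-1) = 0" "deriv V 1 = 0"
proof -
  show "deriv V (-1) = 0"
    by (rule DERIV_local_min[OF C2_DERIV(1)[OF C2] zero_less_one]) (use nonneg wells in auto)
  show "deriv V 1 = 0"
    by (rule DERIV_local_min[OF C2_DERIV(1)[OF C2] zero_less_one]) (use nonneg wells in auto)
qed

lemma double_well_confined: "double_well (confined V) (confined_deriv V)"
proof
  have sq: "((\<lambda>y. (y + k)\<^sup>2) has_real_derivative 2 * (y + k)) (at y)" for y k :: real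
    by (auto intro!: derivative_eq_intros)
  have sq': "((\<lambda>y. (y - 1)\<^sup>2) has_real_derivative 2 * (y - 1)) (at y)" for y :: real
    by (auto intro!: derivative_eq_intros)
  show "(confined V has_real_derivative confined_deriv V y) (at y)" for y
    unfolding confined_def[abs_def] confined_deriv_def
    by (rule DERIV_glue DERIV_glue[OF sq C2_DERIV(1)[OF C2]] sq' | simp add: wells deriv_wells)+
  have "continuous_on A (deriv V)" for A
    using C2_DERIV(2)[OF C2] DERIV_isCont continuous_at_imp_continuous_on by blast
  then show "continuous_on UNIV (confined_deriv V)"
    unfolding confined_deriv_def[abs_def]
    by (intro continuous_on_cases_le continuous_intros) (auto simp: deriv_wells)
  show "0 \<le> confined V y" for y unfolding confined_def using nonneg by auto
  show "confined V y = 0 \<longleftrightarrow> y = 1 \<or> y = - 1" for y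
    using pos[of y] wells by (cases y "1::real" rule: linorder_cases) (auto simp: confined_def)
  fix \<delta> :: real assume \<delta>: "\<delta> > 0"
  define K where "K = {-1..1} \<inter> ({y. \<delta> \<le> \<bar>y - 1\<bar>} \<inter> {y. \<delta> \<le> \<bar>y + 1\<bar>})"
  have "compact K" unfolding K_def
    by (intro compact_Int_closed closed_Int closed_Collect_le continuous_intros) auto
  moreover have "continuous_on K V" using C2_DERIV(1)[OF C2] DERIV_isCont continuous_at_imp_continuous_on by blast
  \<comment> \<open>For \<open>\<delta> > 1\<close> the set \<open>K\<close> is empty, and any
    positive \<open>m\<close> serves.\<close>
  ultimately obtain m where m: "m > 0" "\<And>y. y \<in> K \<Longrightarrow> m \<le> V y"
  proof (cases "K = {}")
    case False
    obtain z where z: "z \<in> K" "\<And>y. y \<in> K \<Longrightarrow> V z \<le> V y"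
      using continuous_attains_inf[OF \<open>compact K\<close> False \<open>continuous_on K V\<close>] by blast
    have "V z > 0" using z(1) \<delta> unfolding K_def by (intro pos) (auto simp: less_le)
    then show ?thesis by (rule that) (rule z(2))
  qed (use that[of 1] in auto)
  have "min m (\<delta>\<^sup>2) \<le> confined V y" if y: "\<delta> \<le> \<bar>y - 1\<bar>" "\<delta> \<le> \<bar>y + 1\<bar>" for y
  proof -
    have "\<delta>\<^sup>2 \<le> (y - 1)\<^sup>2" "\<delta>\<^sup>2 \<le> (y + 1)\<^sup>2"
      using power_mono[OF y(1), of 2] power_mono[OF y(2), of 2] \<delta> by simp_all
    moreover have "m \<le> V y" if "-1 \<le> y" "y \<le> 1" using m(2)[of y] that y unfolding K_def by auto
    ultimately show ?thesis by (auto simp: confined_def)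
  qed
  then show "\<exists>\<mu>>0. \<forall>y. \<delta> \<le> \<bar>y - 1\<bar> \<longrightarrow> \<delta> \<le> \<bar>y + 1\<bar> \<longrightarrow> \<mu> \<le> confined V y"
    using m(1) \<delta> by (intro exI[of _ "min m (\<delta>\<^sup>2)"]) auto
qed

interpretation double_well "confined V" "confined_deriv V"
  by (rule double_well_confined)

text \<open>The force of the quadratic pieces points away from [-1, 1], so the maximum principle
  confines the solution to [-1, 1], where the force is that of \<open>V\<close>. Touching a well
  would happen with zero speed; uniqueness would make the solution constant, against its limit at
  the other end.\<close>

lemma heteroclinic_het_sol:
  assumes x: "heteroclinic (\<lambda>t. a (\<epsilon> * t)) x v"
    and a: "continuous_on UNIV a" "\<And>t. 0 < a t"
  shows "het_sol V a \<epsilon> x"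
proof -
  let ?b = "\<lambda>t. a (\<epsilon> * t)"
  have x1: "\<And>t. (x has_real_derivative v t) (at t)"
    and x2: "\<And>t. (v has_real_derivative ?b t * confined_deriv V (x t)) (at t)"
    and lim: "(x \<longlongrightarrow> -1) at_bot" "(x \<longlongrightarrow> 1) at_top"
    using x unfolding heteroclinic_def by auto
  have le: "x t \<le> 1" for t
    by (rule convex_above_level_imp_le[OF x1 x2 _ lim]) (auto simp: confined_deriv_def a)
  have "- x t \<le> 1" for t
  proof (rule convex_above_level_imp_le[OF DERIV_minus[OF x1] DERIV_minus[OF x2]])
    show "((\<lambda>t. - x t) \<longlongrightarrow> 1) at_bot" "((\<lambda>t. - x t) \<longlongrightarrow> -1) at_top"
      using tendsto_minus[OF lim(1)] tendsto_minus[OF lim(2)] by simp_all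
    show "0 < - (?b t * confined_deriv V (x t))" if "1 < - x t" for t
      using that a(2)[of "\<epsilon> * t"] by (simp add: confined_deriv_def mult_less_0_iff zero_less_mult_iff mult_pos_neg)
  qed auto
  then have ge: "-1 \<le> x t" for t by (simp add: minus_le_iff)
  have cw: "confined_deriv V (x t) = deriv V (x t)" for t
    using le[of t] ge[of t] deriv_wells by (cases "x t = -1") (auto simp: confined_deriv_def)
  have ode: "(v has_real_derivative ?b t * deriv V (x t)) (at t)" for t using x2[of t] unfolding cw .
  have "continuous_on {-1..1} (deriv (deriv V))" using C2 unfolding C2_def by (auto intro: continuous_on_subset)
  then obtain L where L0: "0 \<le> L" and L: "\<And>y. y \<in> {-1..1} \<Longrightarrow> \<bar>deriv (deriv V) y\<bar> \<le> L"
    by (rule continuous_bounded_Icc) (rule that; assumption)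
  have lip: "\<bar>deriv V y - deriv V z\<bar> \<le> L * \<bar>y - z\<bar>" if "y \<in> {-1..1}" "z \<in> {-1..1}" for y z
    using field_differentiable_bound[of "{-1..1}" "deriv V" "deriv (deriv V)" L y z] L that
      has_field_derivative_at_within[OF C2_DERIV(2)[OF C2]] by auto
  have cb: "continuous_on A ?b" for A
    by (intro continuous_on_compose2[OF a(1)] continuous_intros) auto
  \<comment> \<open>Both wells are critical points of \<open>V\<close>, so its Lipschitz derivative
    is bounded linearly by the distance to the well.\<close>
  have bound: "\<exists>M\<ge>0. \<forall>t. \<bar>t\<bar> \<le> R \<longrightarrow> \<bar>?b t * deriv V (x t)\<bar> \<le> M * \<bar>x t - z\<bar>"
    if z: "z \<in> {-1..1}" "deriv V z = 0" for R z
  proof -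
    obtain B where B0: "0 \<le> B" and B: "\<And>t. t \<in> {-R..R} \<Longrightarrow> \<bar>?b t\<bar> \<le> B"
      by (rule continuous_bounded_Icc[OF cb[of "{-R..R}"]]) (rule that; assumption)
    have "\<bar>?b t * deriv V (x t)\<bar> \<le> B * L * \<bar>x t - z\<bar>" if "\<bar>t\<bar> \<le> R" for t
    proof -
      have Bt: "\<bar>?b t\<bar> \<le> B" using B[of t] that by (auto simp: abs_le_iff)
      have "\<bar>?b t * deriv V (x t)\<bar> \<le> B * (L * \<bar>x t - z\<bar>)"
        unfolding abs_mult using lip[of "x t" z] z le[of t] ge[of t] Bt by (intro mult_mono) auto
      then show ?thesis by (simp add: mult.assoc)
    qed
    then show ?thesis using L0 B0 by (intro exI[of _ "B * L"]) auto
  qed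
  have touch: "x r = z" if z: "z \<in> {-1..1}" "deriv V z = 0" and s: "x s = z" "v s = 0" for z s r
  proof -
    have "x r - z = 0"
    proof (rule linear_bound_ode_zero[where u="\<lambda>t. x t - z" and v=v and q="\<lambda>t. ?b t * deriv V (x t)"])
      show "((\<lambda>t. x t - z) has_real_derivative v t) (at t)" for t
        by (auto intro!: derivative_eq_intros x1)
    qed (use ode bound[OF z] s in auto)
    then show ?thesis by simp
  qed
  have "x t < 1" for t
  proof (rule ccontr)
    assume "\<not> x t < 1"
    then have t: "x t = 1" using le[of t] by simp
    have "v t = 0" by (rule DERIV_local_max[OF x1 zero_less_one]) (use t le in auto)
    then have "x = (\<lambda>_. 1)" using touch[OF _ deriv_wells(2) t] by auto
    then show False using lim(1) tendsto_unique[OF trivial_limit_at_bot_linorder lim(1), of 1] by auto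
  qed
  moreover have "-1 < x t" for t
  proof (rule ccontr)
    assume "\<not> -1 < x t"
    then have t: "x t = -1" using ge[of t] by simp
    have "v t = 0" by (rule DERIV_local_min[OF x1 zero_less_one]) (use t ge in auto)
    then have "x = (\<lambda>_. -1)" using touch[OF _ deriv_wells(1) t] by auto
    then show False using lim(2) tendsto_unique[OF trivial_limit_at_top_linorder lim(2), of "-1"] by auto
  qed
  moreover have dx: "deriv x = v" using DERIV_imp_deriv[OF x1] by blast
  moreover have ddx: "deriv v = (\<lambda>t. ?b t * deriv V (x t))" using DERIV_imp_deriv[OF ode] by blast
  moreover have "continuous_on UNIV (\<lambda>t. ?b t * deriv V (x t))"
  proof -
    have "continuous_on UNIV (deriv V)"
      using C2_DERIV(2)[OF C2] DERIV_isCont continuous_at_imp_continuous_on by blast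
    moreover have "continuous_on UNIV x" using x1 DERIV_isCont continuous_at_imp_continuous_on by blast
    ultimately show ?thesis by (intro continuous_intros cb continuous_on_compose2[of UNIV "deriv V" _ x]) auto
  qed
  moreover have "x differentiable at t" "v differentiable at t" for t
    using x1 ode real_differentiable_def by blast+
  ultimately show ?thesis unfolding het_sol_def C2_def using lim by simp
qed

section \<open>The three classes of weights\<close>

lemma het_sol_coercive:
  assumes a: "continuous_on UNIV a" "coercive a" and \<epsilon>: "\<epsilon> > 0"
  shows "\<exists>x. het_sol V a \<epsilon> x"
proof -
  obtain c where c: "c > 0" "\<And>t. c \<le> a t" using a(2) unfolding coercive_def by blast
  have "filterlim (\<lambda>t. \<epsilon> * t) at_infinity (at_infinity :: real filter)"
    by (rule tendsto_mult_filterlim_at_infinity[OF tendsto_const]) (use \<epsilon> in \<open>auto simp: filterlim_ident\<close>)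
  then have inf: "filterlim (\<lambda>t. a (\<epsilon> * t)) at_top at_infinity"
    using a(2) unfolding coercive_def by (blast intro: filterlim_compose)
  have "continuous_on UNIV (\<lambda>t. a (\<epsilon> * t))" by (intro continuous_on_compose2[OF a(1)] continuous_intros) auto
  from heteroclinic_if_coercive[OF this c(1) c(2) inf] obtain x v where "heteroclinic (\<lambda>t. a (\<epsilon> * t)) x v" by blast
  from heteroclinic_het_sol[OF this a(1)] show ?thesis using c by (meson less_le_trans)
qed

lemma het_sol_asymp_periodic:
  assumes a: "continuous_on UNIV a" "asymp_periodic a" and \<epsilon>: "\<epsilon> > 0"
  shows "\<exists>x. het_sol V a \<epsilon> x"
proof -
  obtain p T c where p: "continuous_on UNIV p" "T > 0" "\<And>t. p (t + T) = p t"
      "((\<lambda>t. \<bar>a t - p t\<bar>) \<longlongrightarrow> 0) at_infinity" "\<And>t. a t < p t" and c: "c > 0" "\<And>t. c \<le> a t"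
    using a(2) unfolding asymp_periodic_def by blast
  interpret p: periodic_fun_simple p T by unfold_locales (rule p(3))
  have "continuous_on {0..T} p" by (rule continuous_on_subset[OF p(1)]) auto
  then obtain B where B: "\<And>t. t \<in> {0..T} \<Longrightarrow> \<bar>p t\<bar> \<le> B"
    by (rule continuous_bounded_Icc) (rule that; assumption)
  have pB: "p t \<le> B" for t
  proof -
    have "real_of_int \<lfloor>t / T\<rfloor> * T \<le> t"
      using of_int_floor_le[of "t / T"] unfolding pos_le_divide_eq[OF p(2)] .
    moreover have "t / T < real_of_int \<lfloor>t / T\<rfloor> + 1" by linarith
    then have "t < real_of_int \<lfloor>t / T\<rfloor> * T + T"
      unfolding pos_divide_less_eq[OF p(2)] by (simp add: algebra_simps)
    ultimately have "\<bar>p (t - of_int \<lfloor>t / T\<rfloor> * T)\<bar> \<le> B" by (intro B) auto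
    then show ?thesis by (simp add: p.minus_of_int)
  qed
  let ?b = "\<lambda>t. a (\<epsilon> * t)" and ?b' = "\<lambda>t. p (\<epsilon> * t)"
  have cont: "continuous_on UNIV ?b" "continuous_on UNIV ?b'"
    by (intro continuous_on_compose2[OF a(1)] continuous_on_compose2[OF p(1)] continuous_intros; auto)+
  have scale: "filterlim (\<lambda>t. \<epsilon> * t) at_infinity (at_infinity :: real filter)"
    by (rule tendsto_mult_filterlim_at_infinity[OF tendsto_const]) (use \<epsilon> in \<open>auto simp: filterlim_ident\<close>)
  have "((\<lambda>t. \<bar>?b' t - ?b t\<bar>) \<longlongrightarrow> 0) at_infinity"
    using filterlim_compose[OF p(4) scale] by (simp add: abs_minus_commute)
  then have conv: "((\<lambda>t. ?b' t - ?b t) \<longlongrightarrow> 0) at_infinity" by (rule tendsto_rabs_zero_cancel)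
  have "level ?b < level ?b'"
  proof (rule level_less_periodic[OF cont(1) c(1) _ cont(2)])
    show "0 < T / \<epsilon>" using p(2) \<epsilon> by simp
    show "p (\<epsilon> * (t + T / \<epsilon>)) = p (\<epsilon> * t)" for t using \<epsilon> p(3)[of "\<epsilon> * t"] by (simp add: distrib_left)
  qed (use c p in auto)
  moreover have "?b t \<le> B" for t using p(5)[of "\<epsilon> * t"] pB[of "\<epsilon> * t"] by linarith
  ultimately have "\<exists>x v. heteroclinic ?b x v"
    by (intro heteroclinic_if_level_less[OF cont(1) c(1) _ _ cont(2) _ conv]) (use c less_imp_le[OF p(5)] in auto)
  then obtain x v where "heteroclinic ?b x v" by blast
  from heteroclinic_het_sol[OF this a(1)] show ?thesis using c by (meson less_le_trans)
qed

text \<open>For small \<epsilon> the weight is close to \<open>a 0\<close> on the bounded interval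
  where a fixed transition \<open>y\<close> pays potential. If \<open>y\<close> is nearly optimal
  for the constant \<open>a 0\<close>, its action stays below the level of the constant
  \<open>a1\<close>, and that level is at most the one of \<open>?b'\<close>. The weights
  \<open>?b\<close> and \<open>?b'\<close> agree far out because \<open>a\<close> exceeds
  \<open>a1\<close> there.\<close>

lemma het_sol_small_parameter:
  assumes a: "continuous_on UNIV a" "bounded (range a)" "\<And>t. a 0 \<le> a t" "a 0 > 0"
    and inf: "Liminf at_infinity (\<lambda>t. ereal (a t)) > ereal (a 0)"
  shows "\<exists>\<epsilon>s>0. \<forall>\<epsilon>. 0 < \<epsilon> \<and> \<epsilon> < \<epsilon>s \<longrightarrow> (\<exists>x. het_sol V a \<epsilon> x)"
proof -
  obtain a1 where a1: "ereal (a 0) < ereal a1" "ereal a1 < Liminf at_infinity (\<lambda>t. ereal (a t))"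
    using ereal_dense2[OF inf] by blast
  then have a01: "a 0 < a1" by simp
  have "\<forall>\<^sub>F t in at_infinity. ereal a1 < ereal (a t)" by (rule less_LiminfD[OF a1(2)])
  then obtain R where R: "\<And>t. R \<le> \<bar>t\<bar> \<Longrightarrow> a1 < a t" unfolding eventually_at_infinity by auto
  obtain B where "\<And>t. \<bar>a t\<bar> \<le> B" using a(2) unfolding bounded_real by blast
  then have B: "a t \<le> B" for t by (meson abs_ge_self order_trans)
  \<comment> \<open>Constants are periodic with period 1.\<close>
  have "level (\<lambda>_. a 0) < level (\<lambda>_. a1)"
    by (rule level_less_periodic[of _ "a 0" _ 1]) (use a01 a(4) in auto)
  then obtain y h where y: "transition y h" "action (\<lambda>_. a 0) y h < level (\<lambda>_. a1)"
    using level_approx[of "level (\<lambda>_. a1) - level (\<lambda>_. a 0)" "\<lambda>_. a 0"] by auto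
  obtain S where S: "S > 0" "\<And>t. t \<le> -S \<or> t \<ge> S \<Longrightarrow> confined V (y t) = 0"
    by (rule transition_lagrangianE[OF y(1), of 0]) (rule that; assumption)
  define I where "I = integral {-S..S} (\<lambda>t. confined V (y t))"
  have Wy: "(\<lambda>t. confined V (y t)) integrable_on {-S..S}"
    by (intro integrable_continuous_real W_cont_comp curve_continuous[OF transition_curve[OF y(1)]])
  have I: "I \<ge> 0" unfolding I_def by (rule integral_nonneg[OF Wy]) (rule W_nonneg)
  \<comment> \<open>Raising the weight by at most \<theta> on \<open>{-S..S}\<close> adds at most
    \<open>\<theta> * I\<close> to the action, which is less than the distance to the level of
    \<open>a1\<close>. The summand 1 makes the denominator positive and the inequality
    strict.\<close>
  define \<theta> where "\<theta> = (level (\<lambda>_. a1) - action (\<lambda>_. a 0) y h) / (I + 1)"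
  have \<theta>: "\<theta> > 0" using y(2) I by (simp add: \<theta>_def)
  have "isCont a 0" using a(1) by (simp add: continuous_on_eq_continuous_at)
  then obtain r where r: "r > 0" "\<And>t. \<bar>t\<bar> < r \<Longrightarrow> \<bar>a t - a 0\<bar> < \<theta>"
    using \<theta> unfolding continuous_at_eps_delta dist_real_def by (metis diff_zero)
  \<comment> \<open>The bound \<open>r / S\<close> keeps \<open>\<epsilon> * t\<close> within the
    continuity radius \<open>r\<close> for all \<open>t\<close> in \<open>{-S..S}\<close>.\<close>
  have "\<exists>x. het_sol V a \<epsilon> x" if \<epsilon>: "0 < \<epsilon>" "\<epsilon> < r / S" for \<epsilon>
  proof -
    let ?b = "\<lambda>t. a (\<epsilon> * t)"
    let ?b' = "\<lambda>t. max (?b t) a1"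
    have cb: "continuous_on UNIV ?b" by (intro continuous_on_compose2[OF a(1)] continuous_intros) auto
    have cb': "continuous_on UNIV ?b'" by (intro continuous_intros cb)
    have b0: "0 \<le> ?b t" for t using a(3)[of "\<epsilon> * t"] a(4) by linarith
    have "action ?b y h - action (\<lambda>_. a 0) y h = integral {-S..S} (\<lambda>t. (?b t - a 0) * confined V (y t))"
      by (rule action_diff[OF y(1) _ cb]) (use S(2) in auto)
    also have "\<dots> \<le> integral {-S..S} (\<lambda>t. \<theta> * confined V (y t))"
    proof (rule integral_le)
      show "(\<lambda>t. (?b t - a 0) * confined V (y t)) integrable_on {-S..S}"
        by (intro integrable_continuous_real potential_continuous continuous_intros cb
            curve_continuous[OF transition_curve[OF y(1)]])
      show "(\<lambda>t. \<theta> * confined V (y t)) integrable_on {-S..S}" using integrable_on_cmult_left[OF Wy, of \<theta>] by simp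
      fix t assume t: "t \<in> {-S..S}"
      have "\<bar>\<epsilon> * t\<bar> \<le> \<epsilon> * S" using t \<epsilon>(1) by (simp add: abs_mult abs_le_iff)
      also have "\<dots> < r" using \<epsilon>(2) S(1) by (simp add: pos_less_divide_eq)
      finally have "?b t - a 0 \<le> \<theta>" using r(2)[of "\<epsilon> * t"] by linarith
      then show "(?b t - a 0) * confined V (y t) \<le> \<theta> * confined V (y t)"
        by (rule mult_right_mono) (rule W_nonneg)
    qed
    also have "\<dots> = \<theta> * I" by (simp add: I_def)
    also have "\<dots> < \<theta> * (I + 1)" using \<theta> by simp
    also have "\<dots> = level (\<lambda>_. a1) - action (\<lambda>_. a 0) y h" using I by (simp add: \<theta>_def)
    finally have "level ?b < level (\<lambda>_. a1)" using level_le[OF y(1), where b="?b", OF b0] by linarith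
    also have "\<dots> \<le> level ?b'"
      by (rule level_mono[OF _ cb']) (use a01 a(4) in auto)
    finally have less: "level ?b < level ?b'" .
    have "\<forall>\<^sub>F t in at_infinity. ?b' t - ?b t = 0"
      unfolding eventually_at_infinity
    proof (intro exI allI impI)
      fix t :: real assume "R / \<epsilon> \<le> norm t"
      then have "R \<le> \<bar>\<epsilon> * t\<bar>" using \<epsilon>(1) by (simp add: abs_mult pos_divide_le_eq mult.commute)
      from R[OF this] show "?b' t - ?b t = 0" by simp
    qed
    then have conv: "((\<lambda>t. ?b' t - ?b t) \<longlongrightarrow> 0) at_infinity" by (rule tendsto_eventually)
    have "\<exists>x v. heteroclinic ?b x v"
      by (rule heteroclinic_if_level_less[OF cb a(4) _ _ cb' _ conv less]) (use a(3) B in auto)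
    then obtain x v where "heteroclinic ?b x v" by blast
    from heteroclinic_het_sol[OF this a(1)] show ?thesis using a(3,4) by (meson less_le_trans)
  qed
  moreover have "r / S > 0" using r(1) S(1) by simp
  ultimately show ?thesis by blast
qed

end

theorem theorem1p1:
  fixes V a :: "real \<Rightarrow> real"
  assumes "C2 V"
    and "\<forall>x. V x \<ge> 0" and "V (-1) = 0" and "V 1 = 0"
    and "\<forall>x. -1 < x \<and> x < 1 \<longrightarrow> V x > 0"
    and "deriv (deriv V) (-1) > 0" and "deriv (deriv V) 1 > 0"
    and "continuous_on UNIV a"
  shows "(asymp_periodic a \<or> coercive a \<longrightarrow> (\<forall>\<epsilon>>0. \<exists>x. het_sol V a \<epsilon> x))
       \<and> (bounded (range a) \<and> (\<forall>t. a 0 \<le> a t) \<and> a 0 > 0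
           \<and> Liminf at_infinity (\<lambda>t. ereal (a t)) > ereal (a 0)
          \<longrightarrow> (\<exists>\<epsilon>s>0. \<forall>\<epsilon>. 0 < \<epsilon> \<and> \<epsilon> < \<epsilon>s \<longrightarrow> (\<exists>x. het_sol V a \<epsilon> x)))"
proof -
  have V: "\<And>y. V y \<ge> 0" "\<And>y. -1 < y \<Longrightarrow> y < 1 \<Longrightarrow> V y > 0" using assms by auto
  note hyps = assms(1) V(1) assms(3,4) V(2) assms(8)
  show ?thesis
    using het_sol_coercive[OF hyps] het_sol_asymp_periodic[OF hyps] het_sol_small_parameter[OF hyps] by blast
qed

end
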